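(* Given any natural numbers $k_1,k_2\ge 1$, there are coprime natural numbers $p_1,p_2$ and a natural number $m$ such that the Seifert fibration of $S^3\subset\mathbb C^2$ determined by the $S^1$-action $$\theta(z_1,z_2)=(\mathrm e^{\mathrm ip_1\theta}z_1,\mathrm e^{\mathrm ip_2\theta}z_2),$$ which has base orbifold $S^2(p_1,p_2)$, descends to a Seifert fibration of the left-quotient $$L(m,m-1)=S^3/(z_1,z_2)\sim(\mathrm e^{2\pi\mathrm i/m}z_1,\mathrm e^{-2\pi\mathrm i/m}z_2)$$ with base orbifold $S^2(k_1,k_2)$. For $p_1,p_2$ one may always take the pair of coprime natural numbers with $p_1/p_2=k_1/k_2$, and $m=k_1+k_2$.
   Context: $S^3\subset\mathbb C^2$ is the unit sphere. $S^2(k_1,k_2)$ denotes the $2$-dimensional orbifold with underlying space the $2$-sphere and two cone points of multiplicity $k_1$ and $k_2$ (multiplicity $1$ meaning an ordinary point). The Seifert fibration determined by an $S^1$-action without fixed points is the decomposition into orbits; its base orbifold is the orbit space with cone points of order given by the multiplicity of the singular orbits. *)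

theory Defs
  imports "HOL-Analysis.Analysis" "HOL-Library.Disjoint_Sets"
begin

text \<open>For a partition \<open>P\<close> of \<open>topspace X\<close>, the set \<open>P\<close> with the quotient topology.\<close>

definition decomposition_space :: "'a topology \<Rightarrow> 'a set set \<Rightarrow> 'a set topology" where
  "decomposition_space X P = topology (\<lambda>V. V \<subseteq> P \<and> openin X (\<Union>V))"

lemma partition_on_members_eq:
  assumes "partition_on A P" "f \<in> P" "g \<in> P" "x \<in> f" "x \<in> g"
  shows "f = g"
proof (rule ccontr)
  assume "f \<noteq> g"
  with assms(1-3) have "f \<inter> g = {}"
    by (auto simp: partition_on_def dest: disjointD)
  with assms(4,5) show False by auto
qed

lemma openin_decomposition_space:
  assumes P: "partition_on (topspace X) P"
  shows "openin (decomposition_space X P) V \<longleftrightarrow> V \<subseteq> P \<and> openin X (\<Union>V)"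
proof -
  have "istopology (\<lambda>V. V \<subseteq> P \<and> openin X (\<Union>V))"
    unfolding istopology_def
  proof (rule conjI; intro allI impI)
    fix S T assume S: "S \<subseteq> P \<and> openin X (\<Union>S)" and T: "T \<subseteq> P \<and> openin X (\<Union>T)"
    have "\<Union>S \<inter> \<Union>T \<subseteq> \<Union>(S \<inter> T)"
    proof
      fix x assume "x \<in> \<Union>S \<inter> \<Union>T"
      then obtain f g where fg: "f \<in> S" "x \<in> f" "g \<in> T" "x \<in> g" by auto
      then have "f = g"
        using S T by (intro partition_on_members_eq[OF P, of f g x]) auto
      with fg show "x \<in> \<Union>(S \<inter> T)" by auto
    qed
    then have "\<Union>(S \<inter> T) = \<Union>S \<inter> \<Union>T" by auto
    moreover have "openin X (\<Union>S \<inter> \<Union>T)" using S T by (intro openin_Int) auto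
    ultimately show "S \<inter> T \<subseteq> P \<and> openin X (\<Union>(S \<inter> T))" using S by auto
  next
    fix K assume K: "\<forall>V\<in>K. V \<subseteq> P \<and> openin X (\<Union>V)"
    have "\<Union>(\<Union>K) = \<Union>(Union ` K)" by auto
    moreover have "openin X (\<Union>(Union ` K))" using K by (intro openin_Union) auto
    ultimately show "\<Union>K \<subseteq> P \<and> openin X (\<Union>(\<Union>K))" using K by auto
  qed
  then show ?thesis
    unfolding decomposition_space_def by (simp only: topology_inverse')
qed

lemma topspace_decomposition_space:
  assumes "partition_on (topspace X) P"
  shows "topspace (decomposition_space X P) = P"
proof
  show "topspace (decomposition_space X P) \<subseteq> P"
    using openin_topspace[of "decomposition_space X P"]
    by (simp only: openin_decomposition_space[OF assms])
  have "\<Union>P = topspace X" using assms by (simp add: partition_on_def)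
  then have "openin (decomposition_space X P) P"
    by (simp only: openin_decomposition_space[OF assms] openin_topspace subset_refl simp_thms)
  then show "P \<subseteq> topspace (decomposition_space X P)" by (rule openin_subset)
qed

text \<open>The circle is parametrised as \<open>\<real>/2\<pi>\<int>\<close>. On \<open>S\<^sup>3\<close> the action has no fixed points if both weights
  are nonzero.\<close>

definition circle_action :: "int \<Rightarrow> int \<Rightarrow> real \<Rightarrow> complex \<times> complex \<Rightarrow> complex \<times> complex" where
  "circle_action p1 p2 \<theta> = (\<lambda>(z1, z2).
     (exp (\<i> * of_int p1 * of_real \<theta>) * z1, exp (\<i> * of_int p2 * of_real \<theta>) * z2))"

definition circle_orbits :: "int \<Rightarrow> int \<Rightarrow> (complex \<times> complex) set \<Rightarrow> (complex \<times> complex) set set" where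
  "circle_orbits p1 p2 S = (\<lambda>z. range (\<lambda>\<theta>. circle_action p1 p2 \<theta> z)) ` S"

text \<open>The open solid torus \<open>D\<^sup>2 \<times> S\<^sup>1\<close>. Its standard fibration of type \<open>(\<alpha>, \<beta>)\<close>, obtained from
  \<open>D\<^sup>2 \<times> [0,1]\<close> with the fibres \<open>{z} \<times> [0,1]\<close> by identifying the two ends via the rotation through
  \<open>2\<pi>\<beta>/\<alpha>\<close>, is the decomposition into the orbits of \<open>circle_action \<beta> \<alpha>\<close>: the core
  \<open>{0} \<times> S\<^sup>1\<close> is traversed \<open>\<alpha>\<close> times while any other fibre is traversed once.\<close>

definition solid_torus :: "(complex \<times> complex) set" where
  "solid_torus = ball 0 1 \<times> sphere 0 1"

text \<open>The fibre \<open>f\<close> of the decomposition \<open>F\<close> has a saturated open neighbourhood \<open>U\<close> that is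
  homeomorphic, fibre by fibre, to a standard fibred solid torus of multiplicity \<open>\<alpha>\<close>, with \<open>f\<close>
  going to the core. The number \<open>\<alpha>\<close> is determined by \<open>f\<close>, since the fibres close to \<open>f\<close> represent
  \<open>\<plusminus>\<alpha>\<close> times the class of \<open>f\<close> in the fundamental group \<open>\<int>\<close> of \<open>U\<close>. Fibres of multiplicity 1 are
  the regular ones.\<close>

definition fibre_multiplicity :: "'a topology \<Rightarrow> 'a set set \<Rightarrow> 'a set \<Rightarrow> nat \<Rightarrow> bool" where
  "fibre_multiplicity X F f \<alpha> \<longleftrightarrow> \<alpha> \<ge> 1 \<and>
     (\<exists>U \<beta> h. openin X U \<and> f \<subseteq> U \<and> (\<forall>g\<in>F. g \<inter> U \<noteq> {} \<longrightarrow> g \<subseteq> U) \<and> coprime (int \<alpha>) \<beta> \<and>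
        homeomorphic_map (subtopology X U) (top_of_set solid_torus) h \<and>
        h ` f = {0} \<times> sphere 0 1 \<and>
        (\<lambda>g. h ` g) ` {g \<in> F. g \<subseteq> U} = circle_orbits \<beta> (int \<alpha>) solid_torus)"

text \<open>A (topological) Seifert fibration of the 3-manifold \<open>X\<close>. That \<open>X\<close> is locally Euclidean of
  dimension 3 follows from the existence of the solid torus neighbourhoods.\<close>

definition seifert_fibration :: "'a topology \<Rightarrow> 'a set set \<Rightarrow> bool" where
  "seifert_fibration X F \<longleftrightarrow> Hausdorff_space X \<and> second_countable X \<and>
     partition_on (topspace X) F \<and> (\<forall>f\<in>F. \<exists>\<alpha>. fibre_multiplicity X F f \<alpha>)"

text \<open>A 2-dimensional orbifold all of whose singularities are cone points is described by its
  underlying space together with the order of each of its points, order 1 meaning an ordinary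
  point.\<close>

type_synonym 'a cone_orbifold = "'a topology \<times> ('a \<Rightarrow> nat)"

definition S2_orbifold :: "nat \<Rightarrow> nat \<Rightarrow> (complex \<times> real) cone_orbifold" where
  "S2_orbifold k1 k2 = (top_of_set (sphere 0 1),
     \<lambda>x. if x = (0, 1) then k1 else if x = (0, -1) then k2 else 1)"

definition has_base_orbifold :: "'a topology \<Rightarrow> 'a set set \<Rightarrow> 'b cone_orbifold \<Rightarrow> bool" where
  "has_base_orbifold X F B \<longleftrightarrow>
     (\<exists>h. homeomorphic_map (decomposition_space X F) (fst B) h \<and>
          (\<forall>f\<in>F. fibre_multiplicity X F f (snd B (h f))))"

definition S3 :: "(complex \<times> complex) topology" where
  "S3 = top_of_set (sphere 0 1)"

definition lens_generator :: "nat \<Rightarrow> complex \<times> complex \<Rightarrow> complex \<times> complex" where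
  "lens_generator m = (\<lambda>(z1, z2).
     (exp (2 * of_real pi * \<i> / of_nat m) * z1, exp (- 2 * of_real pi * \<i> / of_nat m) * z2))"

text \<open>The generator has order \<open>m\<close>, so its nonnegative powers form the whole cyclic group.\<close>

definition lens_proj :: "nat \<Rightarrow> complex \<times> complex \<Rightarrow> (complex \<times> complex) set" where
  "lens_proj m z = range (\<lambda>j. (lens_generator m ^^ j) z)"

text \<open>The lens space \<open>L(m, m - 1)\<close>; its points are the \<open>\<int>\<^sub>m\<close>-orbits in \<open>S\<^sup>3\<close>.\<close>

definition lens_space :: "nat \<Rightarrow> (complex \<times> complex) set topology" where
  "lens_space m = decomposition_space S3 (lens_proj m ` topspace S3)"

definition S3_fibration :: "nat \<Rightarrow> nat \<Rightarrow> (complex \<times> complex) set set" where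
  "S3_fibration p1 p2 = circle_orbits (int p1) (int p2) (topspace S3)"

text \<open>The decomposition \<open>F\<close> descends along \<open>q\<close> to the decomposition of the target into the images of
  the members of \<open>F\<close>.\<close>

definition descended :: "('a \<Rightarrow> 'b) \<Rightarrow> 'a set set \<Rightarrow> 'b set set" where
  "descended q F = (\<lambda>f. q ` f) ` F"

definition S3_fibration_descends :: "nat \<Rightarrow> nat \<Rightarrow> nat \<Rightarrow> nat \<Rightarrow> nat \<Rightarrow> bool" where
  "S3_fibration_descends p1 p2 m k1 k2 \<longleftrightarrow>
     seifert_fibration S3 (S3_fibration p1 p2) \<and>
     has_base_orbifold S3 (S3_fibration p1 p2) (S2_orbifold p1 p2) \<and>
     seifert_fibration (lens_space m) (descended (lens_proj m) (S3_fibration p1 p2)) \<and>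
     has_base_orbifold (lens_space m) (descended (lens_proj m) (S3_fibration p1 p2))
       (S2_orbifold k1 k2)"

end

theory Submission
  imports Defs
begin

text \<open>The circle action with weights \<open>p1\<close>, \<open>p2\<close> commutes with the group of \<open>m\<close>-th roots of unity acting by
  \<open>(z1, z2) \<mapsto> (\<zeta> * z1, inverse \<zeta> * z2)\<close>, so the two together act on \<open>S\<^sup>3\<close> through a subgroup \<open>G\<close> of the torus,
  and the fibres of the descended fibration are the images of the \<open>G\<close>-orbits. Put
  \<open>m' = m div gcd m (p1 + p2)\<close>. For every \<open>m\<close> the base orbifold turns out to be \<open>S\<^sup>2(m' * p1, m' * p2)\<close>.
  For \<open>m = 1\<close> this is the fibration of \<open>S\<^sup>3\<close>. If \<open>k1 = d * p1\<close> and \<open>k2 = d * p2\<close>, then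
  \<open>m = k1 + k2 = d * (p1 + p2)\<close> gives \<open>m' = d\<close>, hence the base orbifold \<open>S\<^sup>2(k1, k2)\<close>.

  Underlying space of the base: \<open>G\<close> consists of the pairs \<open>(x, y)\<close> of unit complex numbers with
  \<open>x ^ (m' * p2) = y ^ (m' * p1)\<close> (lemma \<open>torus_subgroup\<close>). Multiplying the angles of \<open>z1\<close> and \<open>z2\<close> by
  \<open>m' * p2\<close> and \<open>m' * p1\<close> therefore turns the \<open>G\<close>-orbits into orbits of the diagonal circle, and composing
  with the Hopf map gives a map \<open>S\<^sup>3 \<rightarrow> S\<^sup>2\<close> whose level sets are the \<open>G\<close>-orbits (lemmas
  \<open>base_map_eq_iff\<close> and \<open>mem_quotient_fibre_iff\<close>). By compactness it is a quotient map, so its target is the base.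

  Multiplicities: the part \<open>z1 \<noteq> 0\<close> of the lens space is an open solid torus with coordinates \<open>u * z2\<close> and
  \<open>u ^ m\<close>, where \<open>u = sgn z1\<close>. In it the circle acts linearly with weights \<open>p1 + p2\<close> and \<open>m * p1\<close>, so after
  division by \<open>gcd m (p1 + p2)\<close> it carries a standard fibration with core \<open>z2 = 0\<close> of multiplicity
  \<open>m' * p1\<close> (lemma \<open>fibre_multiplicity_in_chart\<close>), while all other fibres of a standard fibred solid torus are
  regular (lemma \<open>fibre_multiplicity_off_core\<close>). Swapping the coordinates treats the circle \<open>z1 = 0\<close>. That these
  coordinates are homeomorphisms, and that the lens space is Hausdorff and second countable, is seen by
  embedding it into \<open>\<complex>\<^sup>3\<close> by the invariants \<open>z1 * z2\<close>, \<open>z1 ^ m\<close>, \<open>z2 ^ m\<close>.\<close>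

section \<open>Quotient maps and decomposition spaces\<close>

lemma second_countable_euclidean: "second_countable (euclidean :: 'a::second_countable_topology topology)"
proof -
  obtain B :: "'a set set" where "countable B" "topological_basis B"
    using ex_countable_basis by blast
  then show ?thesis
    unfolding second_countable_def open_openin[symmetric]
    by (meson topological_basisE topological_basis_open)
qed

text \<open>A quotient map is determined up to homeomorphism by its level sets: the map induced by \<open>g\<close> on \<open>X\<close>
  is injective, and it is a quotient map because \<open>g\<close> is one.\<close>

lemma quotient_maps_same_fibres:
  assumes q: "quotient_map Z X q" and g: "quotient_map Z Y g"
    and eq: "\<And>z w. z \<in> topspace Z \<Longrightarrow> w \<in> topspace Z \<Longrightarrow> q z = q w \<longleftrightarrow> g z = g w"
  obtains H where "homeomorphic_map X Y H" "\<And>z. z \<in> topspace Z \<Longrightarrow> H (q z) = g z"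
proof -
  obtain H where H: "continuous_map X Y H" "\<And>z. z \<in> topspace Z \<Longrightarrow> H (q z) = g z"
    using quotient_map_lift_exists[OF q quotient_imp_continuous_map[OF g]] eq by metis
  have "quotient_map Z Y (H \<circ> q)"
    by (rule quotient_map_eq[OF g]) (simp add: H(2))
  then have "quotient_map X Y H"
    by (rule quotient_map_from_composition[OF quotient_imp_continuous_map[OF q] H(1)])
  moreover have "inj_on H (topspace X)"
  proof (rule inj_onI)
    fix x y assume "x \<in> topspace X" "y \<in> topspace X" "H x = H y"
    moreover have "q ` topspace Z = topspace X" using q by (rule quotient_imp_surjective_map)
    ultimately show "x = y" by (metis H(2) eq imageE)
  qed
  ultimately have "homeomorphic_map X Y H" by (simp add: homeomorphic_map_def)
  with H(2) that show thesis by blast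
qed

lemma quotient_map_decomposition_space:
  assumes P: "partition_on (topspace X) P"
    and proj: "\<And>x. x \<in> topspace X \<Longrightarrow> proj x \<in> P \<and> x \<in> proj x"
  shows "quotient_map X (decomposition_space X P) proj"
  unfolding quotient_map_def topspace_decomposition_space[OF P] openin_decomposition_space[OF P]
proof (intro conjI allI impI)
  have UP: "\<Union>P = topspace X" using P by (simp add: partition_on_def)
  have proj_eq: "proj x = f" if "f \<in> P" "x \<in> f" for x f
    using that UP proj[of x] partition_on_members_eq[OF P, of "proj x" f x] by auto
  show "proj ` topspace X = P"
  proof
    show "P \<subseteq> proj ` topspace X"
    proof
      fix f assume f: "f \<in> P"
      then obtain x where "x \<in> f" using P by (fastforce simp: partition_on_def)
      with f UP proj_eq show "f \<in> proj ` topspace X" by blast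
    qed
  qed (use proj in auto)
  fix V assume V: "V \<subseteq> P"
  have "{x \<in> topspace X. proj x \<in> V} = \<Union>V"
    using V UP proj proj_eq by auto
  then show "openin X {x \<in> topspace X. proj x \<in> V} \<longleftrightarrow> V \<subseteq> P \<and> openin X (\<Union>V)"
    using V by simp
qed

text \<open>This identifies the base of a fibration whose fibres are the level sets of a known map: the base is
  the target of that map.\<close>

lemma decomposition_space_of_level_sets:
  assumes p: "quotient_map X Y p"
    and F: "F = (\<lambda>x. {x' \<in> topspace X. p x' = p x}) ` topspace X"
  shows "partition_on (topspace X) F"
    and "\<exists>h. homeomorphic_map (decomposition_space X F) Y h \<and>
             (\<forall>x\<in>topspace X. h {x' \<in> topspace X. p x' = p x} = p x)"
proof -
  show P: "partition_on (topspace X) F"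
    unfolding F partition_on_def by (auto simp: disjoint_def)
  define proj where "proj = (\<lambda>x. {x' \<in> topspace X. p x' = p x})"
  have "quotient_map X (decomposition_space X F) proj"
    by (rule quotient_map_decomposition_space[OF P]) (auto simp: F proj_def)
  moreover have "proj x = proj y \<longleftrightarrow> p x = p y" if "x \<in> topspace X" "y \<in> topspace X" for x y
    using that by (auto simp: proj_def)
  ultimately obtain h where "homeomorphic_map (decomposition_space X F) Y h"
    "\<And>x. x \<in> topspace X \<Longrightarrow> h (proj x) = p x"
    using quotient_maps_same_fibres[OF _ p, of "decomposition_space X F" proj] by blast
  then show "\<exists>h. homeomorphic_map (decomposition_space X F) Y h \<and>
             (\<forall>x\<in>topspace X. h {x' \<in> topspace X. p x' = p x} = p x)"
    unfolding proj_def by blast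
qed

section \<open>The standard fibred solid torus\<close>

text \<open>The multiplicity of a fibre only depends on the fibration near that fibre, up to fibre-preserving
  homeomorphism. It can therefore be computed in any saturated chart.\<close>

lemma fibre_multiplicity_pullback:
  assumes U: "openin X U" and sat: "\<forall>g\<in>F. g \<inter> U \<noteq> {} \<longrightarrow> g \<subseteq> U"
    and h: "homeomorphic_map (subtopology X U) Y h"
    and G: "G = (\<lambda>g. h ` g) ` {g \<in> F. g \<subseteq> U}"
    and f: "f \<in> F" "f \<subseteq> U"
    and mult: "fibre_multiplicity Y G (h ` f) \<alpha>"
  shows "fibre_multiplicity X F f \<alpha>"
proof -
  from mult obtain V \<beta> k where V: "openin Y V" "h ` f \<subseteq> V" "\<forall>g\<in>G. g \<inter> V \<noteq> {} \<longrightarrow> g \<subseteq> V"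
    and cop: "coprime (int \<alpha>) \<beta>"
    and k: "homeomorphic_map (subtopology Y V) (top_of_set solid_torus) k"
      "k ` h ` f = {0} \<times> sphere 0 1"
      "(\<lambda>g. k ` g) ` {g \<in> G. g \<subseteq> V} = circle_orbits \<beta> (int \<alpha>) solid_torus"
    and \<alpha>: "\<alpha> \<ge> 1"
    unfolding fibre_multiplicity_def by (elim conjE exE) (rule that; assumption)
  define W where "W = {x \<in> U. h x \<in> V}"
  have top: "topspace (subtopology X U) = U"
    using openin_subset[OF U] by auto
  have "openin (subtopology X U) W"
    using openin_continuous_map_preimage[OF homeomorphic_imp_continuous_map[OF h] V(1)]
    unfolding top W_def .
  then have "openin X W" using U openin_trans_full by blast
  moreover have "f \<subseteq> W" using f V(2) by (auto simp: W_def)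
  moreover have "\<forall>g\<in>F. g \<inter> W \<noteq> {} \<longrightarrow> g \<subseteq> W"
  proof (intro ballI impI)
    fix g assume g: "g \<in> F" "g \<inter> W \<noteq> {}"
    then have "g \<inter> U \<noteq> {}" by (auto simp: W_def)
    with sat g(1) have gU: "g \<subseteq> U" by blast
    then have "h ` g \<in> G" using g(1) by (auto simp: G)
    moreover have "h ` g \<inter> V \<noteq> {}" using g(2) by (auto simp: W_def)
    ultimately have "h ` g \<subseteq> V" by (rule V(3)[rule_format])
    then show "g \<subseteq> W" using gU by (auto simp: W_def)
  qed
  moreover have "homeomorphic_map (subtopology X W) (top_of_set solid_torus) (k \<circ> h)"
  proof (rule homeomorphic_map_compose[OF _ k(1)])
    have "homeomorphic_map (subtopology (subtopology X U) W) (subtopology Y V) h"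
      by (rule homeomorphic_map_subtopologies_alt[OF h]) (auto simp: W_def top)
    moreover have "U \<inter> W = W" by (auto simp: W_def)
    ultimately show "homeomorphic_map (subtopology X W) (subtopology Y V) h"
      by (simp add: subtopology_subtopology)
  qed
  moreover have "(k \<circ> h) ` f = {0} \<times> sphere 0 1" using k(2) by (simp add: image_comp)
  moreover have "g \<subseteq> W \<longleftrightarrow> g \<subseteq> U \<and> h ` g \<subseteq> V" for g
    by (auto simp: W_def)
  then have "{g \<in> G. g \<subseteq> V} = (\<lambda>g. h ` g) ` {g \<in> F. g \<subseteq> W}"
    unfolding G by blast
  then have "(\<lambda>g. (k \<circ> h) ` g) ` {g \<in> F. g \<subseteq> W} = circle_orbits \<beta> (int \<alpha>) solid_torus"
    using k(3) by (simp add: image_comp comp_def)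
  ultimately show ?thesis
    unfolding fibre_multiplicity_def using \<alpha> cop
    by (intro conjI exI[of _ W] exI[of _ \<beta>] exI[of _ "k \<circ> h"])
qed

lemma unit_complex_eq_cis:
  assumes "cmod x = 1" obtains \<theta> where "x = cis \<theta>"
  using assms by (metis cis_Arg norm_zero sgn_eq zero_neq_one div_by_1 of_real_1)

lemma unit_root_exists:
  assumes "n \<ge> 1" "cmod y = 1"
  obtains x where "cmod x = 1" "x ^ n = y"
proof -
  obtain \<theta> where "y = cis \<theta>" using assms(2) by (rule unit_complex_eq_cis)
  moreover have "cis (\<theta> / n) ^ n = cis (n * (\<theta> / n))" by (rule Complex.DeMoivre)
  ultimately show thesis using assms(1) by (intro that[of "cis (\<theta> / n)"]) simp_all
qed

lemma circle_action_eq: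
  "circle_action p1 p2 \<theta> z = (cis (p1 * \<theta>) * fst z, cis (p2 * \<theta>) * snd z)"
  by (simp add: circle_action_def case_prod_beta cis_conv_exp mult_ac)

lemma circle_action_0 [simp]: "circle_action p1 p2 0 z = z"
  by (simp add: circle_action_eq)

lemma circle_action_add:
  "circle_action p1 p2 \<theta> (circle_action p1 p2 \<eta> z) = circle_action p1 p2 (\<theta> + \<eta>) z"
  by (simp add: circle_action_eq cis_mult distrib_left flip: mult.assoc)

text \<open>A common factor of the weights only changes the speed along the orbits. This is how the weights induced
  in a chart, which need not be coprime, are reduced to the coprime weights of a standard fibred solid torus.\<close>

lemma range_circle_action_common_factor:
  assumes "e \<noteq> 0"
  shows "range (\<lambda>\<theta>. circle_action (e * p1) (e * p2) \<theta> z) = range (\<lambda>\<theta>. circle_action p1 p2 \<theta> z)"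
proof -
  have "(\<lambda>\<theta>. circle_action (e * p1) (e * p2) \<theta> z) = (\<lambda>\<theta>. circle_action p1 p2 \<theta> z) \<circ> (\<lambda>\<theta>. real_of_int e * \<theta>)"
    by (auto simp: circle_action_eq mult_ac)
  moreover have "surj (\<lambda>\<theta>. real_of_int e * \<theta>)"
    using assms by (intro surjI[of _ "\<lambda>x. x / e"]) auto
  ultimately show ?thesis by (simp only: image_comp[symmetric])
qed

lemma range_cis_mult:
  assumes "cmod c = 1"
  shows "range (\<lambda>\<theta>. cis \<theta> * c) = sphere 0 1"
proof (intro equalityI subsetI)
  fix x :: complex assume "x \<in> sphere 0 1"
  then have "cmod (x / c) = 1" using assms by (simp add: norm_divide)
  then obtain \<theta> where "x / c = cis \<theta>" by (rule unit_complex_eq_cis)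
  moreover have "c \<noteq> 0" using assms by auto
  ultimately have "x = cis \<theta> * c" by (simp add: divide_eq_eq)
  then show "x \<in> range (\<lambda>\<theta>. cis \<theta> * c)" by blast
qed (use assms in \<open>auto simp: norm_mult\<close>)

lemma range_circle_action_core:
  assumes "cmod y = 1" "p2 \<noteq> 0"
  shows "range (\<lambda>\<theta>. circle_action p1 p2 \<theta> (0, y)) = {0} \<times> sphere 0 1"
proof -
  have "range (\<lambda>\<theta>. circle_action (p2 * 0) (p2 * 1) \<theta> (0, y)) = range (\<lambda>\<theta>. circle_action 0 1 \<theta> (0, y))"
    by (rule range_circle_action_common_factor[OF assms(2)])
  also have "\<dots> = (\<lambda>x. (0, x)) ` range (\<lambda>\<theta>. cis \<theta> * y)"
    by (auto simp: circle_action_eq)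
  also have "\<dots> = {0} \<times> sphere 0 1"
    unfolding range_cis_mult[OF assms(1)] by auto
  finally show ?thesis by (simp add: circle_action_eq)
qed

lemma fibre_multiplicity_core:
  assumes "\<alpha> \<ge> 1" "coprime (int \<alpha>) \<beta>"
  shows "fibre_multiplicity (top_of_set solid_torus) (circle_orbits \<beta> (int \<alpha>) solid_torus)
    ({0} \<times> sphere 0 1) \<alpha>"
proof -
  have sub: "g \<subseteq> solid_torus" if "g \<in> circle_orbits \<beta> (int \<alpha>) solid_torus" for g
  proof -
    obtain z where "z \<in> solid_torus" "g = range (\<lambda>\<theta>. circle_action \<beta> (int \<alpha>) \<theta> z)"
      using \<open>g \<in> _\<close> by (auto simp only: circle_orbits_def)
    then show ?thesis by (auto simp: solid_torus_def circle_action_eq norm_mult)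
  qed
  then have "{g \<in> circle_orbits \<beta> (int \<alpha>) solid_torus. g \<subseteq> solid_torus}
    = circle_orbits \<beta> (int \<alpha>) solid_torus" by blast
  moreover have "openin (top_of_set solid_torus) solid_torus" by simp
  moreover have "homeomorphic_map (subtopology (top_of_set solid_torus) solid_torus)
      (top_of_set solid_torus) id"
    by (simp add: subtopology_subtopology)
  moreover have "{0} \<times> sphere 0 1 \<subseteq> solid_torus" by (auto simp: solid_torus_def)
  ultimately show ?thesis unfolding fibre_multiplicity_def using sub assms
    by (intro conjI exI[of _ solid_torus] exI[of _ \<beta>] exI[of _ id]) simp_all
qed

lemma norm_circle_action [simp]: "norm (circle_action p1 p2 \<theta> z) = norm z"
  by (simp add: circle_action_eq norm_prod_def norm_mult)

lemma circle_action_sphere: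
  "z \<in> sphere 0 1 \<Longrightarrow> circle_action p1 p2 \<theta> z \<in> sphere 0 1"
  by simp

text \<open>The rule for composing monomial maps of the torus: their exponent matrices are multiplied.\<close>

lemma power_int_matrix_compose:
  fixes a y :: "'a::field"
  assumes "a \<noteq> 0" "y \<noteq> 0"
  shows "(a powi i * y powi j) powi k * (a powi l * y powi n) powi u
    = a powi (i * k + l * u) * y powi (j * k + n * u)"
  by (simp only: power_int_mult_distrib power_int_mult[symmetric] power_int_add[OF disjI1[OF assms(1)]]
      power_int_add[OF disjI1[OF assms(2)]] mult_ac)

text \<open>A fibre off the core is regular. With \<open>s * \<beta> + t * \<alpha> = 1\<close>, the map
  \<open>(a, y) \<mapsto> (a powi \<alpha> * y powi (-\<beta>), a powi s * y powi t)\<close> is an automorphism of the torus, and it turns the action with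
  weights \<open>(\<beta>, \<alpha>)\<close> into the rotation of the second factor. Applied to \<open>a = sgn v\<close>, with the radius \<open>\<bar>v\<bar>\<close>
  kept, it identifies the complement of the core with (punctured disc) \<open>\<times> S\<^sup>1\<close>, fibred by
  the circles over the points of the punctured disc. A small round disc in the punctured disc around the
  image of the given fibre is rescaled to the unit disc.\<close>

lemma fibre_multiplicity_off_core:
  assumes \<alpha>: "\<alpha> \<ge> 1" and cop: "coprime (int \<alpha>) \<beta>"
    and vy: "(v0, y0) \<in> solid_torus" "v0 \<noteq> 0"
  shows "fibre_multiplicity (top_of_set solid_torus) (circle_orbits \<beta> (int \<alpha>) solid_torus)
    (range (\<lambda>\<theta>. circle_action \<beta> (int \<alpha>) \<theta> (v0, y0))) 1"
proof -
  define orb where "orb = (\<lambda>p. range (\<lambda>\<theta>. circle_action \<beta> (int \<alpha>) \<theta> p))"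
  obtain s t where st: "s * \<beta> + t * int \<alpha> = 1"
    using cop bezout_int[of \<beta> "int \<alpha>"] unfolding coprime_iff_gcd_eq_1 gcd.commute[of "int \<alpha>"]
    by auto
  \<comment> \<open>The invariant part \<open>x\<close> gives the point of the punctured disc, \<open>c\<close> the position in the fibre.\<close>
  define A where "A = (\<lambda>p. sgn (fst p) powi int \<alpha> * snd p powi (-\<beta>) :: complex)"
  define x where "x = (\<lambda>p. of_real (cmod (fst p)) * A p)"
  define c where "c = (\<lambda>p. sgn (fst p) powi s * snd p powi t :: complex)"
  define T where "T = {p \<in> solid_torus. fst p \<noteq> 0}"
  have A_norm: "cmod (A p) = 1" and c_norm: "cmod (c p) = 1" if "p \<in> T" for p
    using that by (auto simp: A_def c_def T_def solid_torus_def norm_mult norm_power_int norm_power norm_sgn)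
  have x_norm: "cmod (x p) = cmod (fst p)" if "p \<in> T" for p
    using A_norm[OF that] by (simp add: x_def norm_mult)
  have act: "circle_action \<beta> (int \<alpha>) \<theta> p \<in> T" if "p \<in> T" for p \<theta>
    using that by (auto simp: T_def solid_torus_def circle_action_eq norm_mult)
  have sgn_cis: "sgn (cis \<eta> * z) = cis \<eta> * sgn z" for \<eta> z
    by (simp add: sgn_eq norm_mult)
  have x_act: "x (circle_action \<beta> (int \<alpha>) \<theta> p) = x p" for \<theta> p
  proof -
    have "cis (\<beta> * \<theta>) powi int \<alpha> * cis (int \<alpha> * \<theta>) powi (-\<beta>) = 1"
      by (simp add: cis_power_int Complex.DeMoivre cis_mult mult_ac)
    moreover have "A (circle_action \<beta> (int \<alpha>) \<theta> p)
        = (cis (\<beta> * \<theta>) powi int \<alpha> * cis (int \<alpha> * \<theta>) powi (-\<beta>)) * A p"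
      unfolding A_def circle_action_eq fst_conv snd_conv sgn_cis power_int_mult_distrib
      by (simp only: mult_ac)
    ultimately have "A (circle_action \<beta> (int \<alpha>) \<theta> p) = A p" by (simp only: mult_1)
    then show ?thesis by (simp add: x_def circle_action_eq norm_mult)
  qed
  have c_act: "c (circle_action \<beta> (int \<alpha>) \<theta> p) = cis \<theta> * c p" for \<theta> p
  proof -
    have "real_of_int s * (\<beta> * \<theta>) + t * (int \<alpha> * \<theta>) = real_of_int (s * \<beta> + t * int \<alpha>) * \<theta>"
      by (simp add: algebra_simps)
    then have "cis (s * (\<beta> * \<theta>)) * cis (t * (int \<alpha> * \<theta>)) = cis \<theta>"
      by (simp only: cis_mult st of_int_1 mult_1)
    then show ?thesis
      unfolding c_def circle_action_eq fst_conv snd_conv sgn_cis power_int_mult_distrib cis_power_int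
      by (simp only: mult_ac)
  qed
  define x0 where "x0 = x (v0, y0)"
  have T0: "(v0, y0) \<in> T" using vy by (simp add: T_def)
  have x0: "0 < cmod x0" "cmod x0 < 1"
    using x_norm[OF T0] vy by (auto simp: x0_def solid_torus_def)
  \<comment> \<open>Small enough for the disc of radius \<open>r\<close> around \<open>x0\<close> to avoid 0 and to stay inside the unit disc.\<close>
  define r where "r = min (cmod x0) (1 - cmod x0)"
  have r: "r > 0" using x0 by (simp add: r_def)
  have ball_r: "0 < cmod z" "cmod z < 1" if "cmod (z - x0) < r" for z
  proof -
    show "cmod z < 1" using that norm_triangle_ineq[of "z - x0" x0] by (simp add: r_def)
    have "z \<noteq> 0" using that by (auto simp: r_def)
    then show "0 < cmod z" by simp
  qed
  define V where "V = {p \<in> T. x p \<in> ball x0 r}"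
  define k where "k = (\<lambda>p. ((x p - x0) / of_real r, c p))"
  \<comment> \<open>The inverse \<open>l\<close> of the chart \<open>k\<close> uses the inverse exponent matrix, with rows \<open>(t, \<beta>)\<close> and \<open>(-s, \<alpha>)\<close>.\<close>
  define X where "X = (\<lambda>w. x0 + of_real r * w)"
  define l where "l = (\<lambda>(w, e). (of_real (cmod (X w)) * (sgn (X w) powi t * e powi \<beta>),
      sgn (X w) powi (-s) * e powi int \<alpha>) :: complex \<times> complex)"
  have cont: "continuous_on T x" "continuous_on T c"
    unfolding x_def A_def c_def
    by (intro continuous_intros; force simp: T_def solid_torus_def sgn_zero_iff)+
  have open_T: "openin (top_of_set solid_torus) T"
  proof -
    have "T = solid_torus \<inter> fst -` (- {0})" by (auto simp: T_def)
    moreover have "open (fst -` (- {0}) :: (complex \<times> complex) set)"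
      by (intro open_vimage continuous_intros)
    ultimately show ?thesis by (auto simp: openin_open)
  qed
  have "openin (top_of_set T) (T \<inter> x -` ball x0 r)"
    by (rule continuous_openin_preimage_gen[OF cont(1)]) simp
  moreover have "V = T \<inter> x -` ball x0 r" by (auto simp: V_def)
  ultimately have open_V: "openin (top_of_set solid_torus) V"
    using open_T openin_trans by metis
  have k_mem: "k p \<in> solid_torus" if "p \<in> V" for p
    using that c_norm r by (auto simp: V_def k_def solid_torus_def norm_divide dist_norm norm_minus_commute)
  have X: "0 < cmod (X w)" "cmod (X w) < 1" if "cmod w < 1" for w
    using ball_r[of "X w"] that r by (auto simp: X_def norm_mult)
  have lk: "l (k p) = p" if "p \<in> V" for p
  proof -
    have pT: "p \<in> T" using that by (simp add: V_def)
    have nz: "sgn (fst p) \<noteq> 0" "snd p \<noteq> 0" using pT by (auto simp: T_def solid_torus_def sgn_zero_iff)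
    have Xp: "X (fst (k p)) = x p" using r by (simp add: X_def k_def)
    have "sgn (x p) = A p"
      using A_norm[OF pT] nz(1) by (simp add: x_def sgn_eq norm_mult sgn_zero_iff)
    moreover have "A p powi t * c p powi \<beta> = sgn (fst p)"
      unfolding A_def c_def power_int_matrix_compose[OF nz] using st
      by (simp add: algebra_simps)
    moreover have "A p powi (-s) * c p powi int \<alpha> = snd p"
      unfolding A_def c_def power_int_matrix_compose[OF nz] using st
      by (simp add: algebra_simps)
    moreover have "of_real (cmod (fst p)) * sgn (fst p) = fst p"
      using nz by (simp add: sgn_eq)
    ultimately show ?thesis
      unfolding l_def case_prod_beta Xp by (simp add: k_def x_norm[OF pT] prod_eq_iff)
  qed
  have l: "l (w, e) \<in> V \<and> k (l (w, e)) = (w, e)" if we: "(w, e) \<in> solid_torus" for w e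
  proof -
    have w: "cmod w < 1" and e: "cmod e = 1" using we by (auto simp: solid_torus_def)
    note X = X[OF w]
    have u: "cmod (sgn (X w)) = 1" using X by (simp add: norm_sgn)
    then have nz: "sgn (X w) \<noteq> 0" "e \<noteq> 0" using e by auto
    define a where "a = sgn (X w) powi t * e powi \<beta>"
    define y where "y = sgn (X w) powi (-s) * e powi int \<alpha>"
    have ay: "cmod a = 1" "cmod y = 1" unfolding a_def y_def norm_mult norm_power_int u e by simp_all
    have l_eq: "l (w, e) = (of_real (cmod (X w)) * a, y)" by (simp add: l_def a_def y_def)
    have sgn_l: "sgn (fst (l (w, e))) = a" using ay X by (simp add: l_eq sgn_eq norm_mult)
    have lT: "l (w, e) \<in> T" using X ay by (auto simp: l_eq T_def solid_torus_def norm_mult)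
    have "A (l (w, e)) = sgn (X w)"
      unfolding A_def sgn_l unfolding l_eq snd_conv a_def y_def power_int_matrix_compose[OF nz]
      using st by (simp add: algebra_simps)
    then have xl: "x (l (w, e)) = X w"
      using x_norm[OF lT] ay X unfolding x_def by (simp add: l_eq norm_mult sgn_eq)
    have "c (l (w, e)) = e"
      unfolding c_def sgn_l unfolding l_eq snd_conv a_def y_def power_int_matrix_compose[OF nz]
      using st by (simp add: algebra_simps)
    moreover have "dist x0 (X w) < r" using w r by (simp add: X_def dist_norm norm_mult)
    ultimately show ?thesis using lT xl r by (simp add: V_def k_def X_def)
  qed
  have kV: "k ` V = solid_torus" using k_mem l by force
  have hom: "homeomorphic_map (top_of_set V) (top_of_set solid_torus) k"
  proof -
    have "continuous_on V k"
      unfolding k_def using r cont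
      by (intro continuous_intros) (auto intro: continuous_on_subset simp: V_def)
    moreover have "continuous_on solid_torus l"
    proof -
      have "fst p \<in> ball 0 1 \<Longrightarrow> X (fst p) \<noteq> 0" for p :: "complex \<times> complex"
        using X(1)[of "fst p"] by auto
      moreover have "continuous_on S (\<lambda>p. X (fst p))" for S :: "(complex \<times> complex) set"
        unfolding X_def by (intro continuous_intros)
      ultimately show ?thesis unfolding l_def case_prod_beta
        by (intro continuous_intros) (auto simp: solid_torus_def sgn_zero_iff)
    qed
    ultimately have "homeomorphic_maps (top_of_set V) (top_of_set solid_torus) k l"
      unfolding homeomorphic_maps_def using k_mem l lk
      by (auto simp: continuous_map_in_subtopology)
    then show ?thesis by (auto simp: homeomorphic_map_maps)
  qed
  have orb_self: "p \<in> orb p" for p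
    unfolding orb_def by (metis circle_action_0 rangeI)
  have orb_V: "orb p \<subseteq> V" if "p \<in> V" for p
    unfolding orb_def using that act[of p] x_act[of _ p] by (simp add: image_subset_iff V_def)
  have V_orb: "p \<in> V" if "q \<in> orb p" "q \<in> V" for p q
  proof -
    from that(1) obtain \<theta> where q: "q = circle_action \<beta> (int \<alpha>) \<theta> p" by (auto simp: orb_def)
    have "p = circle_action \<beta> (int \<alpha>) (-\<theta>) q" unfolding q circle_action_add by simp
    then show ?thesis using orb_V[OF that(2)] by (auto simp: orb_def)
  qed
  have k_orb: "k ` orb p = {fst (k p)} \<times> sphere 0 1" if "p \<in> V" for p
  proof -
    have "k ` orb p = (\<lambda>e. (fst (k p), e)) ` range (\<lambda>\<theta>. cis \<theta> * c p)"
      unfolding orb_def image_image by (simp add: k_def x_act c_act)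
    also have "range (\<lambda>\<theta>. cis \<theta> * c p) = sphere 0 1"
      using that c_norm by (intro range_cis_mult) (auto simp: V_def)
    finally show ?thesis by auto
  qed
  have orbits: "circle_orbits \<beta> (int \<alpha>) solid_torus = orb ` solid_torus"
    by (simp add: circle_orbits_def orb_def)
  have "{g \<in> orb ` solid_torus. g \<subseteq> V} = orb ` V"
  proof (intro equalityI subsetI)
    fix g assume "g \<in> {g \<in> orb ` solid_torus. g \<subseteq> V}"
    then obtain p where "g = orb p" "orb p \<subseteq> V" by auto
    then show "g \<in> orb ` V" using orb_self by blast
  next
    fix g assume "g \<in> orb ` V"
    then show "g \<in> {g \<in> orb ` solid_torus. g \<subseteq> V}" using orb_V by (auto simp: V_def T_def)
  qed
  then have "(\<lambda>g. k ` g) ` {g \<in> orb ` solid_torus. g \<subseteq> V} = (\<lambda>p. {fst (k p)} \<times> sphere 0 1) ` V"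
    using k_orb by (auto simp: image_image intro!: image_cong)
  also have "\<dots> = (\<lambda>p. {fst p} \<times> sphere 0 1) ` solid_torus"
    unfolding kV[symmetric] image_image ..
  also have "\<dots> = circle_orbits 0 1 solid_torus"
    unfolding circle_orbits_def
  proof (rule image_cong)
    fix p assume "p \<in> solid_torus"
    then have "cmod (snd p) = 1" by (auto simp: solid_torus_def)
    then have "{fst p} \<times> sphere 0 1 = Pair (fst p) ` range (\<lambda>\<theta>. cis \<theta> * snd p)"
      unfolding range_cis_mult[OF \<open>cmod (snd p) = 1\<close>] by auto
    then show "{fst p} \<times> sphere 0 1 = range (\<lambda>\<theta>. circle_action 0 1 \<theta> p)"
      by (simp add: circle_action_eq image_image)
  qed simp
  finally have orbits_k: "(\<lambda>g. k ` g) ` {g \<in> orb ` solid_torus. g \<subseteq> V} = circle_orbits 0 (int 1) solid_torus"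
    by simp
  have V0: "(v0, y0) \<in> V" using T0 r by (simp add: V_def x0_def)
  have "k ` orb (v0, y0) = {0} \<times> sphere 0 1"
    unfolding k_orb[OF V0] by (simp add: k_def x0_def)
  moreover have "\<forall>g\<in>orb ` solid_torus. g \<inter> V \<noteq> {} \<longrightarrow> g \<subseteq> V"
    using V_orb orb_V by blast
  moreover have "homeomorphic_map (subtopology (top_of_set solid_torus) V) (top_of_set solid_torus) k"
    using hom by (simp add: subtopology_subtopology V_def T_def Collect_conj_eq Int_absorb1 flip: Int_assoc)
  ultimately have "fibre_multiplicity (top_of_set solid_torus) (orb ` solid_torus) (orb (v0, y0)) 1"
    unfolding fibre_multiplicity_def using open_V orb_V[OF V0] orbits_k
    by (intro conjI exI[of _ V] exI[of _ 0] exI[of _ k]) simp_all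
  then show ?thesis unfolding orbits by (simp only: orb_def)
qed

lemma fibre_multiplicity_solid_torus:
  assumes "\<alpha> \<ge> 1" "coprime (int \<alpha>) \<beta>" "t \<in> solid_torus"
  shows "fibre_multiplicity (top_of_set solid_torus) (circle_orbits \<beta> (int \<alpha>) solid_torus)
    (range (\<lambda>\<theta>. circle_action \<beta> (int \<alpha>) \<theta> t)) (if fst t = 0 then \<alpha> else 1)"
proof (cases "fst t = 0")
  case True
  have "range (\<lambda>\<theta>. circle_action \<beta> (int \<alpha>) \<theta> (0, snd t)) = {0} \<times> sphere 0 1"
    using assms by (intro range_circle_action_core) (auto simp: solid_torus_def)
  moreover have "t = (0, snd t)" using True by (simp add: prod_eq_iff)
  ultimately show ?thesis using fibre_multiplicity_core[OF assms(1,2)] True by simp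
next
  case False
  then show ?thesis
    using fibre_multiplicity_off_core[OF assms(1,2), of "fst t" "snd t"] assms(3) by simp
qed

section \<open>A map of the 3-sphere onto the 2-sphere with torus orbits as level sets\<close>

text \<open>The map \<open>r * cis t \<mapsto> r * cis (n * t)\<close>. Unlike \<open>z \<mapsto> z ^ n\<close> it preserves the norm, so that applying it
  to both coordinates maps the unit sphere of \<open>\<complex>\<^sup>2\<close> to itself.\<close>

definition angle_power :: "nat \<Rightarrow> complex \<Rightarrow> complex" where
  "angle_power n z = of_real (cmod z) * sgn z ^ n"

text \<open>The Hopf map composed with \<open>angle_power b \<times> angle_power a\<close>.\<close>

definition base_map :: "nat \<Rightarrow> nat \<Rightarrow> complex \<times> complex \<Rightarrow> complex \<times> real" where
  "base_map a b z = (2 * angle_power b (fst z) * cnj (angle_power a (snd z)),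
     (cmod (fst z))\<^sup>2 - (cmod (snd z))\<^sup>2)"

lemma norm_angle_power [simp]: "cmod (angle_power n z) = cmod z"
  by (cases "z = 0") (simp_all add: angle_power_def norm_mult norm_power norm_sgn)

lemma angle_power_unit_mult: "cmod x = 1 \<Longrightarrow> angle_power n (x * z) = x ^ n * angle_power n z"
  by (simp add: angle_power_def norm_mult sgn_eq power_mult_distrib power_divide)

lemma continuous_on_angle_power: "continuous_on S (angle_power n)"
proof -
  have "isCont (angle_power n) z" for z
  proof (cases "z = 0")
    case False
    then show ?thesis unfolding angle_power_def by (intro continuous_intros) auto
  next
    case True
    have "((\<lambda>z. cmod (angle_power n z)) \<longlongrightarrow> 0) (at 0)"
      unfolding norm_angle_power by (rule tendsto_norm_zero) (rule tendsto_ident_at)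
    then have "(angle_power n \<longlongrightarrow> 0) (at 0)" by (rule tendsto_norm_zero_cancel)
    moreover have "angle_power n 0 = 0" by (simp add: angle_power_def)
    ultimately show ?thesis unfolding True isCont_def by simp
  qed
  then show ?thesis by (simp add: continuous_at_imp_continuous_on)
qed

lemma continuous_on_base_map: "continuous_on S (base_map a b)"
proof -
  have ap: "continuous_on S (\<lambda>z. angle_power n (f z))" if "continuous_on S f" for n and f :: "complex \<times> complex \<Rightarrow> complex"
    using continuous_on_compose2[OF continuous_on_angle_power that] by auto
  then show ?thesis unfolding base_map_def
    by (intro continuous_intros ap)
qed

text \<open>The fibres of the Hopf map are the orbits of the diagonal circle, so points with equal image differ by
  unit factors \<open>x\<close> and \<open>y\<close> such that \<open>x ^ b\<close> and \<open>y ^ a\<close> agree. A vanishing coordinate leaves its factor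
  undetermined, and then a suitable root of the other power can be chosen.\<close>

lemma base_map_eq_iff:
  assumes ab: "a \<ge> 1" "b \<ge> 1"
    and z: "(cmod (fst z))\<^sup>2 + (cmod (snd z))\<^sup>2 = 1" and w: "(cmod (fst w))\<^sup>2 + (cmod (snd w))\<^sup>2 = 1"
  shows "base_map a b z = base_map a b w \<longleftrightarrow>
    (\<exists>x y. cmod x = 1 \<and> cmod y = 1 \<and> x ^ b = y ^ a \<and> w = (x * fst z, y * snd z))"
proof -
  define P where "P = (\<lambda>z. angle_power b (fst z) * cnj (angle_power a (snd z)))"
  have P_mult: "P (x * u, y * v) = x ^ b * cnj (y ^ a) * P (u, v)" if "cmod x = 1" "cmod y = 1" for x y u v
    using that by (simp add: P_def angle_power_unit_mult)
  have unit: "x * cnj y = 1 \<longleftrightarrow> x = y" if "cmod y = 1" for x y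
  proof -
    have "y * cnj y = 1" using that by (simp add: complex_norm_square[symmetric])
    then show ?thesis by (metis mult.assoc mult.commute mult_1)
  qed
  have base: "base_map a b z = (2 * P z, (cmod (fst z))\<^sup>2 - (cmod (snd z))\<^sup>2)" for z
    by (simp add: base_map_def P_def)
  show ?thesis
  proof
    assume eq: "base_map a b z = base_map a b w"
    then have "(cmod (fst z))\<^sup>2 = (cmod (fst w))\<^sup>2" "(cmod (snd z))\<^sup>2 = (cmod (snd w))\<^sup>2"
      using z w unfolding base prod.inject by linarith+
    then have norms: "cmod (fst z) = cmod (fst w)" "cmod (snd z) = cmod (snd w)"
      by (simp_all add: power2_eq_iff_nonneg)
    consider "fst z = 0" | "snd z = 0" | "fst z \<noteq> 0" "snd z \<noteq> 0" by blast
    then show "\<exists>x y. cmod x = 1 \<and> cmod y = 1 \<and> x ^ b = y ^ a \<and> w = (x * fst z, y * snd z)"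
    proof cases
      case 1
      then have nz: "snd z \<noteq> 0" using z by auto
      then have nz': "snd w \<noteq> 0" using norms by (metis norm_eq_zero)
      then have y: "cmod (snd w / snd z) = 1" using norms by (simp add: norm_divide)
      obtain x where "cmod x = 1" "x ^ b = (snd w / snd z) ^ a"
        using unit_root_exists[OF ab(2), of "(snd w / snd z) ^ a"] y by (auto simp: norm_power)
      with y nz nz' 1 norms show ?thesis
        by (intro exI[of _ x] exI[of _ "snd w / snd z"]) (auto simp: prod_eq_iff)
    next
      case 2
      then have nz: "fst z \<noteq> 0" using z by auto
      then have nz': "fst w \<noteq> 0" using norms by (metis norm_eq_zero)
      then have y: "cmod (fst w / fst z) = 1" using norms by (simp add: norm_divide)
      obtain x where "cmod x = 1" "x ^ a = (fst w / fst z) ^ b"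
        using unit_root_exists[OF ab(1), of "(fst w / fst z) ^ b"] y by (auto simp: norm_power)
      with y nz nz' 2 norms show ?thesis
        by (intro exI[of _ "fst w / fst z"] exI[of _ x]) (auto simp: prod_eq_iff)
    next
      case 3
      define x y where "x = fst w / fst z" and "y = snd w / snd z"
      have xy: "cmod x = 1" "cmod y = 1" "w = (x * fst z, y * snd z)"
        using 3 norms by (auto simp: x_def y_def norm_divide prod_eq_iff)
      have "P w = x ^ b * cnj (y ^ a) * P z" using P_mult[OF xy(1,2), of "fst z" "snd z"] xy(3) by simp
      moreover have "P z = P w" using eq by (simp add: base)
      moreover have "P z \<noteq> 0"
      proof -
        have "cmod (P z) = cmod (fst z) * cmod (snd z)" by (simp add: P_def norm_mult)
        with 3 show ?thesis by force
      qed
      ultimately have "x ^ b * cnj (y ^ a) = 1" by auto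
      then have "x ^ b = y ^ a" using unit[of "y ^ a"] xy by (simp add: norm_power)
      with xy show ?thesis by blast
    qed
  next
    assume "\<exists>x y. cmod x = 1 \<and> cmod y = 1 \<and> x ^ b = y ^ a \<and> w = (x * fst z, y * snd z)"
    then obtain x y where xy: "cmod x = 1" "cmod y = 1" "x ^ b = y ^ a" "w = (x * fst z, y * snd z)" by blast
    have "x ^ b * cnj (y ^ a) = 1" using unit[of "y ^ a" "x ^ b"] xy by (simp add: norm_power)
    then have "P w = P z" using P_mult[OF xy(1,2), of "fst z" "snd z"] xy(4) by simp
    then show "base_map a b z = base_map a b w" using xy by (simp add: base norm_mult)
  qed
qed

lemma base_map_image:
  assumes ab: "b \<ge> 1"
  shows "base_map a b ` sphere 0 1 = sphere 0 1"
proof (intro equalityI subsetI)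
  fix p assume "p \<in> base_map a b ` sphere 0 1"
  then obtain z where z: "z \<in> sphere 0 1" "p = base_map a b z" by blast
  then have z1: "(cmod (fst z))\<^sup>2 + (cmod (snd z))\<^sup>2 = 1" by (simp add: norm_prod_def)
  have "(cmod (fst p))\<^sup>2 + (snd p)\<^sup>2 = ((cmod (fst z))\<^sup>2 + (cmod (snd z))\<^sup>2)\<^sup>2"
    by (simp add: z(2) base_map_def norm_mult) algebra
  then show "p \<in> sphere 0 1" by (simp add: z1 norm_prod_def)
next
  fix p :: "complex \<times> real" assume "p \<in> sphere 0 1"
  then obtain u t where p: "p = (u, t)" and ut: "(cmod u)\<^sup>2 + t\<^sup>2 = 1"
    by (cases p) (auto simp: norm_prod_def)
  have t: "\<bar>t\<bar> \<le> 1" using ut by (metis abs_le_square_iff abs_one le_add_same_cancel2 one_power2 zero_le_power2)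
  define r1 r2 where "r1 = sqrt ((1 + t) / 2)" and "r2 = sqrt ((1 - t) / 2)"
  have r: "r1 \<ge> 0" "r2 \<ge> 0" "r1\<^sup>2 = (1 + t) / 2" "r2\<^sup>2 = (1 - t) / 2"
    using t by (auto simp: r1_def r2_def)
  have "(2 * r1 * r2)\<^sup>2 = (cmod u)\<^sup>2"
    using ut by (simp add: power_mult_distrib r) (simp add: field_simps power2_eq_square)
  then have u: "2 * r1 * r2 = cmod u" using r by (simp add: power2_eq_iff_nonneg)
  obtain \<eta> where \<eta>: "cmod \<eta> = 1" "u = of_real (cmod u) * \<eta>"
  proof (cases "u = 0")
    case False
    then show thesis by (intro that[of "sgn u"]) (simp add: norm_sgn, simp add: sgn_eq)
  qed (use that[of 1] in simp)
  obtain x where x: "cmod x = 1" "x ^ b = \<eta>" using unit_root_exists[OF ab \<eta>(1)] .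
  define z where "z = (x * of_real r1, of_real r2 :: complex)"
  have real: "angle_power n (of_real s) = of_real s" if "s \<ge> 0" for n s
    using that by (cases "s = 0") (auto simp: angle_power_def sgn_eq)
  have "base_map a b z = (of_real (2 * r1 * r2) * \<eta>, r1\<^sup>2 - r2\<^sup>2)"
    using x r(1,2) by (simp add: base_map_def z_def angle_power_unit_mult real norm_mult)
  also have "\<dots> = p" unfolding u using \<eta>(2) by (simp add: p r field_simps)
  finally have "base_map a b z = p" .
  moreover have "z \<in> sphere 0 1" using x r by (simp add: z_def norm_prod_def norm_mult)
  ultimately show "p \<in> base_map a b ` sphere 0 1" by blast
qed

lemma base_map_poles:
  assumes "(cmod (fst z))\<^sup>2 + (cmod (snd z))\<^sup>2 = 1"
  shows "base_map a b z = (0, 1) \<longleftrightarrow> snd z = 0" "base_map a b z = (0, -1) \<longleftrightarrow> fst z = 0"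
proof -
  have "angle_power n 0 = 0" for n by (simp add: angle_power_def)
  moreover have "(cmod (fst z))\<^sup>2 - (cmod (snd z))\<^sup>2 = 1 \<longleftrightarrow> (cmod (snd z))\<^sup>2 = 0"
    "(cmod (fst z))\<^sup>2 - (cmod (snd z))\<^sup>2 = -1 \<longleftrightarrow> (cmod (fst z))\<^sup>2 = 0"
    using assms by linarith+
  ultimately show "base_map a b z = (0, 1) \<longleftrightarrow> snd z = 0" "base_map a b z = (0, -1) \<longleftrightarrow> fst z = 0"
    by (auto simp: base_map_def)
qed

text \<open>The combined action of the circle and of the \<open>m\<close>-th roots of unity on \<open>\<complex>\<^sup>2\<close> is through a closed
  subgroup of the torus; here it is cut out by a single character. For the nontrivial inclusion choose
  \<open>l\<close> with \<open>l ^ (p1 + p2) = x * y\<close>. Then \<open>(x, y)\<close> differs from \<open>(l ^ p1, l ^ p2)\<close> by \<open>(z, inverse z)\<close>, and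
  the equation says \<open>z ^ (m * P) = 1\<close> with \<open>P = (p1 + p2) div gcd m (p1 + p2)\<close>. The choice of \<open>l\<close> is free
  up to a \<open>(p1 + p2)\<close>-th root of unity \<open>\<mu>\<close>, which changes \<open>z ^ m\<close> by \<open>\<mu> ^ (p1 * m)\<close>. As \<open>p1 * m'\<close> is
  coprime to \<open>P\<close>, these are all the \<open>P\<close>-th roots of unity, so \<open>z ^ m = 1\<close> can be achieved.\<close>

lemma torus_subgroup:
  fixes p1 p2 m :: nat
  defines "m' \<equiv> m div gcd m (p1 + p2)"
  assumes m: "m \<ge> 1" and p: "p1 \<ge> 1" "coprime p1 p2"
    and x: "cmod x = 1" and y: "cmod y = 1"
  shows "x ^ (m' * p2) = y ^ (m' * p1) \<longleftrightarrow>
    (\<exists>\<zeta> \<theta>. \<zeta> ^ m = 1 \<and> x = \<zeta> * cis (real p1 * \<theta>) \<and> y = inverse \<zeta> * cis (real p2 * \<theta>))"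
proof -
  define e where "e = gcd m (p1 + p2)"
  define P where "P = (p1 + p2) div e"
  have e: "e \<ge> 1" using m by (simp add: e_def Suc_le_eq)
  have m': "m = e * m'" and P: "p1 + p2 = e * P" by (simp_all add: m'_def P_def e_def)
  have pos: "m' \<ge> 1" "P \<ge> 1" using m p m' P by (auto simp: Suc_le_eq intro!: Nat.gr0I)
  have "coprime m' P" unfolding m'_def P_def e_def using m by (intro div_gcd_coprime) simp
  moreover have "coprime p1 P"
  proof -
    have "coprime p1 (p1 + p2)" using p(2) by (simp add: coprime_iff_gcd_eq_1)
    then show ?thesis unfolding P by simp
  qed
  ultimately have cop: "coprime (p1 * m') P" by simp
  show ?thesis
  proof
    assume eq: "x ^ (m' * p2) = y ^ (m' * p1)"
    obtain l where l: "cmod l = 1" "l ^ (p1 + p2) = x * y"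
      using unit_root_exists[of "p1 + p2" "x * y"] p x y by (auto simp: norm_mult)
    have l0: "l \<noteq> 0" using l by auto
    define z where "z = x / l ^ p1"
    have nz: "z \<noteq> 0" "x \<noteq> 0" using x l0 by (auto simp: z_def)
    have xz: "x = z * l ^ p1" using l0 by (simp add: z_def)
    have "l ^ p1 * l ^ p2 = z * l ^ p1 * y" using l(2) xz by (simp add: power_add)
    then have yz: "y = inverse z * l ^ p2" using l0 nz by (simp add: field_simps)
    have "z ^ (m' * p2) * l ^ (p1 * (m' * p2)) = inverse z ^ (m' * p1) * l ^ (p2 * (m' * p1))"
      using eq unfolding xz yz by (simp only: power_mult_distrib power_mult[symmetric])
    then have "z ^ (m' * p2) = inverse z ^ (m' * p1)" using l0 by (simp add: mult_ac)
    then have "z ^ (m' * p1 + m' * p2) = 1" using nz by (simp add: power_add power_inverse)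
    moreover have "m' * p1 + m' * p2 = m * P" using m' P by (metis distrib_left mult.assoc mult.commute)
    ultimately have "z ^ (m * P) = 1" by simp
    then obtain n where n: "z = cis (2 * pi * real n / real (m * P))"
      using complex_roots_unity[of "m * P"] m pos by (auto simp: cis_conv_exp mult_ac)
    obtain u v where uv: "u * int (p1 * m') + v * int P = 1"
      using bezout_int[of "int (p1 * m')" "int P"] cop
      unfolding coprime_int_iff[symmetric] coprime_iff_gcd_eq_1 by auto
    \<comment> \<open>This correction is chosen such that \<open>\<mu> ^ (p1 * m) = z ^ m\<close>.\<close>
    define \<mu> where "\<mu> = cis (2 * pi * (u * n) / real (p1 + p2))"
    have "\<mu> ^ (p1 + p2) = cis (real (p1 + p2) * (2 * pi * (u * n) / real (p1 + p2)))"
      unfolding \<mu>_def by (rule Complex.DeMoivre)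
    also have "\<dots> = cis (2 * pi * of_int (u * n))" using p by simp
    also have "\<dots> = 1" by (rule cis_multiple_2pi) simp
    finally have \<mu>: "\<mu> ^ (p1 + p2) = 1" .
    have "cmod (l * \<mu>) = 1" using l by (simp add: norm_mult \<mu>_def)
    then obtain \<theta> where \<theta>: "l * \<mu> = cis \<theta>" by (rule unit_complex_eq_cis)
    define \<zeta> where "\<zeta> = z / \<mu> ^ p1"
    have \<mu>0: "\<mu> \<noteq> 0" by (simp add: \<mu>_def)
    have x\<zeta>: "x = \<zeta> * cis (real p1 * \<theta>)"
      unfolding Complex.DeMoivre[symmetric] \<theta>[symmetric] \<zeta>_def using xz \<mu>0 by (simp add: power_mult_distrib)
    have "\<mu> ^ p1 * \<mu> ^ p2 = 1" using \<mu> by (simp add: power_add)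
    then have y\<zeta>: "y = inverse \<zeta> * cis (real p2 * \<theta>)"
      unfolding Complex.DeMoivre[symmetric] \<theta>[symmetric] \<zeta>_def yz by (simp add: power_mult_distrib field_simps nz)
    have "\<zeta> ^ m = cis (real m * (2 * pi * real n / real (m * P))) / cis (real (p1 * m) * (2 * pi * (u * n) / real (p1 + p2)))"
      unfolding \<zeta>_def n \<mu>_def power_divide power_mult[symmetric] Complex.DeMoivre
      by (simp only: of_nat_mult mult_ac)
    also have "\<dots> = cis (2 * pi * of_int (n * v))"
    proof -
      have "real m * (2 * pi * real n / real (m * P)) = 2 * pi * real n / P" using m by simp
      moreover have "real (p1 * m) * (2 * pi * (u * n) / real (p1 + p2)) = 2 * pi * n * (u * (p1 * m')) / P"
        unfolding P using e pos by (simp add: m' field_simps)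
      moreover have "1 - real_of_int (u * (p1 * m')) = v * P"
      proof -
        have "1 - u * int (p1 * m') = v * int P" using uv by simp
        then show ?thesis by (metis of_int_1 of_int_diff of_int_mult of_int_of_nat_eq of_nat_mult)
      qed
      moreover have "2 * pi * real n / P - 2 * pi * n * (u * (p1 * m')) / P
          = 2 * pi * real n * (1 - real_of_int (u * (p1 * m'))) / P"
        by (simp add: diff_divide_distrib right_diff_distrib)
      moreover have "2 * pi * real n * (v * P) / P = 2 * pi * of_int (n * v)"
        using pos by simp
      ultimately show ?thesis by (simp only: cis_divide)
    qed
    also have "\<dots> = 1" by (rule cis_multiple_2pi) simp
    finally show "\<exists>\<zeta> \<theta>. \<zeta> ^ m = 1 \<and> x = \<zeta> * cis (real p1 * \<theta>) \<and> y = inverse \<zeta> * cis (real p2 * \<theta>)"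
      using x\<zeta> y\<zeta> by blast
  next
    assume "\<exists>\<zeta> \<theta>. \<zeta> ^ m = 1 \<and> x = \<zeta> * cis (real p1 * \<theta>) \<and> y = inverse \<zeta> * cis (real p2 * \<theta>)"
    then obtain \<zeta> \<theta> where \<zeta>: "\<zeta> ^ m = 1" and xy: "x = \<zeta> * cis (real p1 * \<theta>)" "y = inverse \<zeta> * cis (real p2 * \<theta>)"
      by blast
    have "\<zeta> \<noteq> 0" using x xy(1) by auto
    have "\<zeta> ^ (m' * p2) * \<zeta> ^ (m' * p1) = (\<zeta> ^ m) ^ P"
      unfolding power_mult[symmetric] power_add[symmetric] using m' P
      by (metis distrib_left mult.assoc mult.commute add.commute)
    also have "\<dots> = 1" using \<zeta> by simp
    finally have "\<zeta> ^ (m' * p2) = inverse \<zeta> ^ (m' * p1)"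
      using \<open>\<zeta> \<noteq> 0\<close> by (simp add: power_inverse field_simps)
    then show "x ^ (m' * p2) = y ^ (m' * p1)"
      unfolding xy power_mult_distrib Complex.DeMoivre by (simp add: mult_ac)
  qed
qed

section \<open>Lens spaces in terms of invariants\<close>

lemma norm_root_of_unity:
  assumes "\<zeta> ^ m = 1" "m \<ge> 1"
  shows "cmod \<zeta> = 1"
proof (rule power_eq_imp_eq_base)
  show "cmod \<zeta> ^ m = 1 ^ m" using assms(1) by (simp flip: norm_power)
qed (use assms(2) in auto)

text \<open>Generators of the ring of polynomials in \<open>z1\<close>, \<open>z2\<close> that are invariant under
  \<open>(z1, z2) \<mapsto> (\<zeta> * z1, inverse \<zeta> * z2)\<close> for \<open>\<zeta> ^ m = 1\<close>. They embed the lens space into \<open>\<complex>\<^sup>3\<close>, where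
  its charts are given by explicit formulas.\<close>

definition lens_invariants :: "nat \<Rightarrow> complex \<times> complex \<Rightarrow> complex \<times> complex \<times> complex" where
  "lens_invariants m z = (fst z * snd z, fst z ^ m, snd z ^ m)"

lemma lens_invariants_eq_iff:
  assumes m: "m \<ge> 1"
  shows "lens_invariants m z = lens_invariants m w \<longleftrightarrow>
    (\<exists>\<zeta>. \<zeta> ^ m = 1 \<and> w = (\<zeta> * fst z, inverse \<zeta> * snd z))"
proof
  assume eq: "lens_invariants m z = lens_invariants m w"
  then have prod: "fst z * snd z = fst w * snd w" and pow1: "fst z ^ m = fst w ^ m"
    and pow2: "snd z ^ m = snd w ^ m"
    by (auto simp: lens_invariants_def)
  have zero: "fst z = 0 \<longleftrightarrow> fst w = 0" "snd z = 0 \<longleftrightarrow> snd w = 0"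
    using pow1 pow2 m by (metis power_eq_0_iff zero_less_one less_le_trans zero_power)+
  show "\<exists>\<zeta>. \<zeta> ^ m = 1 \<and> w = (\<zeta> * fst z, inverse \<zeta> * snd z)"
  proof (cases "fst z = 0")
    case True
    show ?thesis
    proof (cases "snd z = 0")
      case False
      with True zero pow2 show ?thesis
        by (intro exI[of _ "snd z / snd w"]) (auto simp: power_divide prod_eq_iff)
    qed (use True zero in \<open>auto intro!: exI[of _ 1] simp: prod_eq_iff\<close>)
  next
    case False
    with zero pow1 prod show ?thesis
      by (intro exI[of _ "fst w / fst z"]) (auto simp: power_divide prod_eq_iff field_simps)
  qed
next
  assume "\<exists>\<zeta>. \<zeta> ^ m = 1 \<and> w = (\<zeta> * fst z, inverse \<zeta> * snd z)"
  then obtain \<zeta> where \<zeta>: "\<zeta> ^ m = 1" "w = (\<zeta> * fst z, inverse \<zeta> * snd z)" by blast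
  moreover have "\<zeta> \<noteq> 0" using \<zeta>(1) m by (auto simp: power_0_left split: if_splits)
  ultimately show "lens_invariants m z = lens_invariants m w"
    by (simp add: lens_invariants_def power_mult_distrib power_inverse)
qed

lemma continuous_on_lens_invariants: "continuous_on S (lens_invariants m)"
  unfolding lens_invariants_def by (intro continuous_intros)

lemma topspace_S3 [simp]: "topspace S3 = sphere 0 1"
  by (simp add: S3_def)

text \<open>The lens space \<open>L(m, m - 1)\<close> presented by an arbitrary quotient map. This covers \<open>S\<^sup>3\<close> itself, with
  \<open>m = 1\<close> and the identity, and makes the two coordinates interchangeable: composing \<open>q\<close> with the swap of
  the coordinates gives another such presentation.\<close>

locale lens_quotient =
  fixes m :: nat and X :: "'a topology" and q :: "complex \<times> complex \<Rightarrow> 'a"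
  assumes m_pos: "m \<ge> 1"
    and quot: "quotient_map S3 X q"
    and q_eq_iff: "\<And>z w. z \<in> sphere 0 1 \<Longrightarrow> w \<in> sphere 0 1 \<Longrightarrow>
      q z = q w \<longleftrightarrow> (\<exists>\<zeta>. \<zeta> ^ m = 1 \<and> w = (\<zeta> * fst z, inverse \<zeta> * snd z))"
begin

lemma q_image: "q ` sphere 0 1 = topspace X"
  using quotient_imp_surjective_map[OF quot] by simp

lemma S3_quotient_homeomorphism:
  fixes g :: "complex \<times> complex \<Rightarrow> 'b::metric_space"
  assumes g: "continuous_on (sphere 0 1) g"
    and eq: "\<And>z w. z \<in> sphere 0 1 \<Longrightarrow> w \<in> sphere 0 1 \<Longrightarrow> q z = q w \<longleftrightarrow> g z = g w"
  obtains H where "homeomorphic_map X (top_of_set (g ` sphere 0 1)) H"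
    "\<And>z. z \<in> sphere 0 1 \<Longrightarrow> H (q z) = g z"
proof -
  have "quotient_map S3 (top_of_set (g ` sphere 0 1)) g"
  proof (rule T1_Spaces.continuous_imp_quotient_map)
    show "continuous_map S3 (top_of_set (g ` sphere 0 1)) g"
      using g by (auto simp: S3_def continuous_map_in_subtopology)
  qed (auto simp: S3_def compact_space_subtopology Hausdorff_space_subtopology)
  from quotient_maps_same_fibres[OF quot this] eq that show thesis by auto
qed

lemma invariants_embedding:
  obtains H where "homeomorphic_map X (top_of_set (lens_invariants m ` sphere 0 1)) H"
    "\<And>z. z \<in> sphere 0 1 \<Longrightarrow> H (q z) = lens_invariants m z"
proof -
  obtain H where "homeomorphic_map X (top_of_set (lens_invariants m ` sphere 0 1)) H"
    "\<And>z. z \<in> sphere 0 1 \<Longrightarrow> H (q z) = lens_invariants m z"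
  proof (rule S3_quotient_homeomorphism[of "lens_invariants m"])
    show "q z = q w \<longleftrightarrow> lens_invariants m z = lens_invariants m w"
      if "z \<in> sphere 0 1" "w \<in> sphere 0 1" for z w
      by (simp only: q_eq_iff[OF that] lens_invariants_eq_iff[OF m_pos])
  qed (rule continuous_on_lens_invariants, blast)
  with that show thesis by blast
qed

lemma Hausdorff_and_second_countable: "Hausdorff_space X" "second_countable X"
proof -
  obtain H where "homeomorphic_map X (top_of_set (lens_invariants m ` sphere 0 1)) H"
    by (rule invariants_embedding)
  then have "X homeomorphic_space top_of_set (lens_invariants m ` sphere 0 1)"
    by (rule homeomorphic_map_imp_homeomorphic_space)
  then show "Hausdorff_space X" "second_countable X"
    by (auto simp: homeomorphic_Hausdorff_space homeomorphic_space_second_countability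
        Hausdorff_space_subtopology
        second_countable_subtopology second_countable_euclidean)
qed

end

lemma sphere_prod_iff: "z \<in> sphere (0 :: complex \<times> complex) 1 \<longleftrightarrow> (cmod (fst z))\<^sup>2 + (cmod (snd z))\<^sup>2 = 1"
  by (simp add: norm_prod_def)

text \<open>The part of \<open>S\<^sup>3\<close> with \<open>z1 \<noteq> 0\<close> is a solid torus with coordinates \<open>z2\<close> and \<open>u = sgn z1\<close>. The
  group of \<open>m\<close>-th roots of unity acts on it by \<open>(z2, u) \<mapsto> (inverse \<zeta> * z2, \<zeta> * u)\<close>, and \<open>u * z2\<close> and
  \<open>u ^ m\<close> are coordinates on the quotient, which is again a solid torus.\<close>

definition torus_coordinates :: "nat \<Rightarrow> complex \<times> complex \<Rightarrow> complex \<times> complex" where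
  "torus_coordinates m z = (sgn (fst z) * snd z, sgn (fst z) ^ m)"

lemma torus_coordinates_image:
  assumes m: "m \<ge> 1"
  shows "torus_coordinates m ` {z \<in> sphere 0 1. fst z \<noteq> 0} = solid_torus"
proof (intro equalityI subsetI)
  fix t assume "t \<in> torus_coordinates m ` {z \<in> sphere 0 1. fst z \<noteq> 0}"
  then obtain z where z: "z \<in> sphere 0 1" "fst z \<noteq> 0" "t = torus_coordinates m z" by auto
  then have "(cmod (snd z))\<^sup>2 < 1\<^sup>2" unfolding sphere_prod_iff
    by (metis add.commute less_add_same_cancel1 norm_eq_zero power_one zero_less_power2)
  then have "cmod (snd z) < 1" by (rule power_less_imp_less_base) simp
  then show "t \<in> solid_torus" using z(2,3)
    by (simp add: torus_coordinates_def solid_torus_def norm_mult norm_power norm_sgn)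
next
  fix t assume "t \<in> solid_torus"
  then obtain v y where t: "t = (v, y)" "cmod v < 1" "cmod y = 1"
    by (auto simp: solid_torus_def)
  obtain u where u: "cmod u = 1" "u ^ m = y" using unit_root_exists[OF m t(3)] .
  define r where "r = sqrt (1 - (cmod v)\<^sup>2)"
  have r: "r > 0" "r\<^sup>2 = 1 - (cmod v)\<^sup>2"
    using t(2) by (auto simp: r_def abs_square_less_1 less_imp_le)
  define z where "z = (of_real r * u, v / u)"
  have "sgn (of_real r * u) = u" using r u(1) by (simp add: sgn_eq norm_mult)
  then have "torus_coordinates m z = t"
    using u by (auto simp: torus_coordinates_def z_def t)
  moreover have "z \<in> sphere 0 1" "fst z \<noteq> 0" using r u(1)
    unfolding sphere_prod_iff by (auto simp: z_def norm_mult norm_divide)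
  ultimately show "t \<in> torus_coordinates m ` {z \<in> sphere 0 1. fst z \<noteq> 0}" by force
qed

text \<open>In terms of the invariants, \<open>\<bar>z1\<bar>\<close> is the \<open>m\<close>-th root of \<open>\<bar>z1 ^ m\<bar>\<close>; conversely
  \<open>\<bar>z1\<bar> = sqrt (1 - \<bar>v\<bar>\<^sup>2)\<close> for \<open>v = u * z2\<close>. Hence both the coordinate change and its inverse are continuous
  without choosing \<open>m\<close>-th roots in \<open>\<complex>\<close>.\<close>

lemma invariants_homeomorphic_solid_torus:
  assumes m: "m \<ge> 1"
  obtains \<psi> where
    "homeomorphic_map (top_of_set (lens_invariants m ` {z \<in> sphere 0 1. fst z \<noteq> 0}))
       (top_of_set solid_torus) \<psi>"
    "\<And>z. z \<in> sphere 0 1 \<Longrightarrow> fst z \<noteq> 0 \<Longrightarrow> \<psi> (lens_invariants m z) = torus_coordinates m z"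
proof -
  define W where "W = {z \<in> sphere (0 :: complex \<times> complex) 1. fst z \<noteq> 0}"
  define \<psi> :: "complex \<times> complex \<times> complex \<Rightarrow> complex \<times> complex"
    where "\<psi> = (\<lambda>p. (fst p / of_real (root m (cmod (fst (snd p)))), sgn (fst (snd p))))"
  define \<phi> :: "complex \<times> complex \<Rightarrow> complex \<times> complex \<times> complex"
    where "\<phi> = (\<lambda>t. (of_real (sqrt (1 - (cmod (fst t))\<^sup>2)) * fst t,
       of_real (sqrt (1 - (cmod (fst t))\<^sup>2)) ^ m * snd t, fst t ^ m / snd t))"
  have \<psi>: "\<psi> (lens_invariants m z) = torus_coordinates m z" if "z \<in> W" for z
  proof -
    have "root m (cmod (fst z ^ m)) = cmod (fst z)"
      using m by (simp add: norm_power real_root_power_cancel)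
    moreover have "sgn (fst z ^ m) = sgn (fst z) ^ m"
      by (simp add: sgn_eq norm_power power_divide)
    ultimately show ?thesis
      by (simp add: \<psi>_def lens_invariants_def torus_coordinates_def sgn_eq)
  qed
  have \<phi>: "\<phi> (torus_coordinates m z) = lens_invariants m z" if "z \<in> W" for z
  proof -
    have nz: "fst z \<noteq> 0" using that by (simp add: W_def)
    have "1 - (cmod (snd z))\<^sup>2 = (cmod (fst z))\<^sup>2"
      using that unfolding W_def mem_Collect_eq sphere_prod_iff by linarith
    moreover have "cmod (sgn (fst z) * snd z) = cmod (snd z)"
      using nz by (simp add: norm_mult norm_sgn)
    moreover have "of_real (cmod (fst z)) * sgn (fst z) = fst z"
      using nz by (simp add: sgn_eq)
    moreover have "(sgn (fst z) * snd z) ^ m / sgn (fst z) ^ m = snd z ^ m"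
      using nz by (simp add: power_mult_distrib sgn_zero_iff)
    ultimately show ?thesis
      by (simp add: \<phi>_def lens_invariants_def torus_coordinates_def
          flip: power_mult_distrib mult.assoc)
  qed
  have im: "torus_coordinates m ` W = solid_torus"
    unfolding W_def by (rule torus_coordinates_image[OF m])
  have "homeomorphic_maps (top_of_set (lens_invariants m ` W)) (top_of_set solid_torus) \<psi> \<phi>"
    unfolding homeomorphic_maps_def
  proof (intro conjI)
    have "continuous_on (lens_invariants m ` W) \<psi>"
      unfolding \<psi>_def by (intro continuous_intros) (use m in \<open>auto simp: lens_invariants_def W_def\<close>)
    then show "continuous_map (top_of_set (lens_invariants m ` W)) (top_of_set solid_torus) \<psi>"
      using \<psi> im by (auto simp: continuous_map_in_subtopology)
    have "continuous_on solid_torus \<phi>"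
      unfolding \<phi>_def by (intro continuous_intros) (auto simp: solid_torus_def)
    then show "continuous_map (top_of_set solid_torus) (top_of_set (lens_invariants m ` W)) \<phi>"
      using \<phi> by (auto simp: continuous_map_in_subtopology im[symmetric])
  qed (use \<psi> \<phi> in \<open>auto simp: im[symmetric]\<close>)
  then have "homeomorphic_map (top_of_set (lens_invariants m ` W)) (top_of_set solid_torus) \<psi>"
    by (auto simp: homeomorphic_map_maps)
  with that \<psi> show thesis unfolding W_def by blast
qed

context lens_quotient
begin

lemma solid_torus_chart:
  defines "U \<equiv> q ` {z \<in> sphere 0 1. fst z \<noteq> 0}"
  obtains h where "openin X U" "\<And>z. z \<in> sphere 0 1 \<Longrightarrow> q z \<in> U \<longleftrightarrow> fst z \<noteq> 0"
    "homeomorphic_map (subtopology X U) (top_of_set solid_torus) h"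
    "\<And>z. z \<in> sphere 0 1 \<Longrightarrow> fst z \<noteq> 0 \<Longrightarrow> h (q z) = torus_coordinates m z"
proof -
  have mem: "q z \<in> U \<longleftrightarrow> fst z \<noteq> 0" if z: "z \<in> sphere 0 1" for z
  proof
    assume "q z \<in> U"
    then obtain w where "w \<in> sphere 0 1" "fst w \<noteq> 0" "q z = q w" by (auto simp: U_def)
    with q_eq_iff[OF z, of w] show "fst z \<noteq> 0" by auto
  qed (use z in \<open>auto simp: U_def\<close>)
  have "openin S3 {z \<in> sphere 0 1. q z \<in> U}"
  proof -
    have "{z \<in> sphere 0 1. q z \<in> U} = sphere 0 1 \<inter> fst -` (- {0})" using mem by auto
    moreover have "open (fst -` (- {0}) :: (complex \<times> complex) set)"
      by (intro open_vimage continuous_intros)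
    ultimately show ?thesis by (auto simp: S3_def openin_open)
  qed
  moreover have "U \<subseteq> topspace X" using q_image by (auto simp: U_def)
  ultimately have open_U: "openin X U" using quot by (auto simp: quotient_map_def)
  obtain H where H: "homeomorphic_map X (top_of_set (lens_invariants m ` sphere 0 1)) H"
    "\<And>z. z \<in> sphere 0 1 \<Longrightarrow> H (q z) = lens_invariants m z"
    by (rule invariants_embedding, blast)
  obtain \<psi> where \<psi>: "homeomorphic_map (top_of_set (lens_invariants m ` {z \<in> sphere 0 1. fst z \<noteq> 0}))
       (top_of_set solid_torus) \<psi>"
    "\<And>z. z \<in> sphere 0 1 \<Longrightarrow> fst z \<noteq> 0 \<Longrightarrow> \<psi> (lens_invariants m z) = torus_coordinates m z"
    by (rule invariants_homeomorphic_solid_torus[OF m_pos], blast)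
  let ?W = "{z \<in> sphere 0 1. fst z \<noteq> 0}"
  have "H ` (topspace X \<inter> U) = lens_invariants m ` ?W"
  proof -
    have "topspace X \<inter> U = q ` ?W" using q_image by (auto simp: U_def)
    then show ?thesis using H(2) by (auto simp: image_comp intro!: image_cong)
  qed
  then have "homeomorphic_map (subtopology X U)
      (subtopology (top_of_set (lens_invariants m ` sphere 0 1)) (lens_invariants m ` ?W)) H"
    by (intro homeomorphic_map_subtopologies[OF H(1)]) auto
  moreover have "lens_invariants m ` sphere 0 1 \<inter> lens_invariants m ` ?W = lens_invariants m ` ?W"
    by auto
  ultimately have "homeomorphic_map (subtopology X U) (top_of_set (lens_invariants m ` ?W)) H"
    by (simp add: subtopology_subtopology)
  from homeomorphic_map_compose[OF this \<psi>(1)] show thesis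
    using H(2) \<psi>(2) by (intro that[OF open_U mem]) auto
qed

end

section \<open>The descended fibration\<close>

lemma div_gcd_ge_1: "m \<ge> 1 \<Longrightarrow> m div gcd m n \<ge> (1 :: nat)"
  using dvd_div_eq_0_iff[of "gcd m n" m] by (simp add: Suc_le_eq)

definition quotient_fibre :: "(complex \<times> complex \<Rightarrow> 'a) \<Rightarrow> nat \<Rightarrow> nat \<Rightarrow> complex \<times> complex \<Rightarrow> 'a set" where
  "quotient_fibre q p1 p2 z = q ` range (\<lambda>\<theta>. circle_action (int p1) (int p2) \<theta> z)"

lemma mem_quotient_fibre_self: "q z \<in> quotient_fibre q p1 p2 z"
  unfolding quotient_fibre_def by (metis circle_action_0 rangeI imageI)

lemma descended_S3_fibration:
  "descended q (S3_fibration p1 p2) = quotient_fibre q p1 p2 ` sphere 0 1"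
  by (auto simp: descended_def S3_fibration_def circle_orbits_def quotient_fibre_def S3_def)

context lens_quotient
begin

text \<open>In the coordinates \<open>(u * z2, u ^ m)\<close> of the chart the circle acts with weights \<open>p1 + p2\<close> and \<open>m * p1\<close>.
  Division by their greatest common divisor \<open>e = gcd m (p1 + p2)\<close> gives the standard fibration of type
  \<open>(\<alpha>, \<beta>) = (m div e * p1, (p1 + p2) div e)\<close>, with the circle \<open>z2 = 0\<close> as core.\<close>

lemma fibre_multiplicity_in_chart:
  assumes p: "p1 \<ge> 1" "coprime p1 p2"
    and z: "z \<in> sphere 0 1" "fst z \<noteq> 0"
  shows "fibre_multiplicity X (quotient_fibre q p1 p2 ` sphere 0 1) (quotient_fibre q p1 p2 z)
    (if snd z = 0 then m div gcd m (p1 + p2) * p1 else 1)"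
proof -
  define e where "e = gcd m (p1 + p2)"
  define \<alpha> where "\<alpha> = m div e * p1"
  define \<beta> where "\<beta> = int ((p1 + p2) div e)"
  define U where "U = q ` {z \<in> sphere 0 1. fst z \<noteq> 0}"
  have e: "e \<ge> 1" using m_pos by (simp add: e_def Suc_le_eq)
  have m_eq: "m = e * (m div e)" and P_eq: "p1 + p2 = e * ((p1 + p2) div e)"
    by (simp_all add: e_def)
  have \<alpha>: "\<alpha> \<ge> 1" using m_eq m_pos p by (auto simp: \<alpha>_def Suc_le_eq intro!: Nat.gr0I)
  have cop: "coprime (int \<alpha>) \<beta>"
  proof -
    have "coprime (m div e) ((p1 + p2) div e)"
      unfolding e_def using m_pos by (intro div_gcd_coprime) simp
    moreover have "coprime p1 (e * ((p1 + p2) div e))"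
      using p(2) unfolding P_eq[symmetric] by (simp add: coprime_iff_gcd_eq_1)
    ultimately show ?thesis by (simp add: \<alpha>_def \<beta>_def)
  qed
  obtain h where U: "openin X U" and U_iff: "\<And>z. z \<in> sphere 0 1 \<Longrightarrow> q z \<in> U \<longleftrightarrow> fst z \<noteq> 0"
    and h: "homeomorphic_map (subtopology X U) (top_of_set solid_torus) h"
    and h_q: "\<And>z. z \<in> sphere 0 1 \<Longrightarrow> fst z \<noteq> 0 \<Longrightarrow> h (q z) = torus_coordinates m z"
    unfolding U_def by (rule solid_torus_chart, blast)
  let ?f = "quotient_fibre q p1 p2"
  have fst_act: "fst (circle_action (int p1) (int p2) \<theta> w) = 0 \<longleftrightarrow> fst w = 0" for \<theta> w
    by (simp add: circle_action_eq)
  have fib_U: "?f w \<subseteq> U" if "w \<in> sphere 0 1" "fst w \<noteq> 0" for w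
    using that by (simp add: quotient_fibre_def image_subset_iff U_iff fst_act)
  have fib_U': "fst w \<noteq> 0" if w: "w \<in> sphere 0 1" "?f w \<inter> U \<noteq> {}" for w
  proof -
    obtain \<theta> where "q (circle_action (int p1) (int p2) \<theta> w) \<in> U"
      using w(2) unfolding quotient_fibre_def by blast
    then show ?thesis using w(1) by (simp add: U_iff fst_act)
  qed
  have sat: "\<forall>g\<in>?f ` sphere 0 1. g \<inter> U \<noteq> {} \<longrightarrow> g \<subseteq> U"
    using fib_U fib_U' by blast
  have coords: "torus_coordinates m (circle_action (int p1) (int p2) \<theta> w)
      = circle_action (int (p1 + p2)) (int (m * p1)) \<theta> (torus_coordinates m w)" for \<theta> w
  proof -
    have "sgn (cis \<eta> * u) = cis \<eta> * sgn u" for \<eta> u by (simp add: sgn_eq norm_mult)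
    moreover have "cis (real p1 * \<theta>) * cis (real p2 * \<theta>) = cis (real (p1 + p2) * \<theta>)"
      by (simp add: cis_mult distrib_right)
    ultimately show ?thesis
      by (simp add: torus_coordinates_def circle_action_eq power_mult_distrib Complex.DeMoivre mult_ac)
  qed
  have h_fib: "h ` ?f w = range (\<lambda>\<theta>. circle_action \<beta> (int \<alpha>) \<theta> (torus_coordinates m w))"
    if w: "w \<in> sphere 0 1" "fst w \<noteq> 0" for w
  proof -
    have "h ` ?f w = range (\<lambda>\<theta>. circle_action (int (p1 + p2)) (int (m * p1)) \<theta> (torus_coordinates m w))"
      unfolding quotient_fibre_def image_image coords[symmetric]
      using w by (intro image_cong refl h_q) (simp_all only: circle_action_sphere fst_act not_False_eq_True)
    also have "int (p1 + p2) = int e * \<beta>" using P_eq by (simp only: \<beta>_def of_nat_mult[symmetric])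
    also have "m * p1 = e * \<alpha>" using m_eq by (simp add: \<alpha>_def)
    then have "int (m * p1) = int e * int \<alpha>" by (simp only: of_nat_mult)
    also have "range (\<lambda>\<theta>. circle_action (int e * \<beta>) (int e * int \<alpha>) \<theta> (torus_coordinates m w))
        = range (\<lambda>\<theta>. circle_action \<beta> (int \<alpha>) \<theta> (torus_coordinates m w))"
      using e by (intro range_circle_action_common_factor) simp
    finally show ?thesis .
  qed
  have "{g \<in> ?f ` sphere 0 1. g \<subseteq> U} = ?f ` {w \<in> sphere 0 1. fst w \<noteq> 0}"
  proof -
    have "w \<in> sphere 0 1 \<Longrightarrow> ?f w \<subseteq> U \<longleftrightarrow> fst w \<noteq> 0" for w
      using fib_U[of w] fib_U'[of w] mem_quotient_fibre_self[of q w p1 p2] by blast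
    then show ?thesis by auto
  qed
  then have "(\<lambda>g. h ` g) ` {g \<in> ?f ` sphere 0 1. g \<subseteq> U}
      = (\<lambda>t. range (\<lambda>\<theta>. circle_action \<beta> (int \<alpha>) \<theta> t)) ` torus_coordinates m ` {w \<in> sphere 0 1. fst w \<noteq> 0}"
    unfolding image_image by (auto simp: h_fib image_image intro!: image_cong)
  then have G: "circle_orbits \<beta> (int \<alpha>) solid_torus = (\<lambda>g. h ` g) ` {g \<in> ?f ` sphere 0 1. g \<subseteq> U}"
    by (simp only: torus_coordinates_image[OF m_pos] circle_orbits_def)
  have t: "torus_coordinates m z \<in> solid_torus"
    using z torus_coordinates_image[OF m_pos] by blast
  have "fst (torus_coordinates m z) = 0 \<longleftrightarrow> snd z = 0"
    using z(2) by (simp add: torus_coordinates_def sgn_zero_iff)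
  then have "fibre_multiplicity (top_of_set solid_torus) (circle_orbits \<beta> (int \<alpha>) solid_torus)
      (h ` ?f z) (if snd z = 0 then \<alpha> else 1)"
    using fibre_multiplicity_solid_torus[OF \<alpha> cop t] by (simp only: h_fib[OF z])
  from fibre_multiplicity_pullback[OF U sat h G _ _ this] show ?thesis
    using z fib_U[OF z] by (auto simp: \<alpha>_def e_def split: if_splits)
qed

lemma lens_quotient_swap: "lens_quotient m X (q \<circ> prod.swap)"
proof
  have norm_swap: "norm (prod.swap z) = norm z" for z :: "complex \<times> complex"
    by (simp add: norm_prod_def add.commute)
  have "homeomorphic_map S3 S3 prod.swap"
  proof -
    have "continuous_map S3 S3 prod.swap"
      by (auto simp: S3_def continuous_map_in_subtopology norm_prod_def add.commute prod.swap_def intro!: continuous_intros)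
    then have "homeomorphic_maps S3 S3 prod.swap prod.swap"
      by (simp add: homeomorphic_maps_def)
    then show ?thesis by (auto simp: homeomorphic_map_maps)
  qed
  then show "quotient_map S3 X (q \<circ> prod.swap)"
    using quot by (auto intro: quotient_map_compose simp: homeomorphic_map_def)
  fix z w :: "complex \<times> complex" assume zw: "z \<in> sphere 0 1" "w \<in> sphere 0 1"
  have "(q \<circ> prod.swap) z = (q \<circ> prod.swap) w \<longleftrightarrow>
      (\<exists>\<zeta>. \<zeta> ^ m = 1 \<and> w = (inverse \<zeta> * fst z, \<zeta> * snd z))"
    using q_eq_iff[of "prod.swap z" "prod.swap w"] zw by (auto simp: norm_swap prod_eq_iff)
  also have "\<dots> \<longleftrightarrow> (\<exists>\<zeta>. \<zeta> ^ m = 1 \<and> w = (\<zeta> * fst z, inverse \<zeta> * snd z))"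
    by (metis inverse_inverse_eq power_inverse inverse_1)
  finally show "(q \<circ> prod.swap) z = (q \<circ> prod.swap) w \<longleftrightarrow>
      (\<exists>\<zeta>. \<zeta> ^ m = 1 \<and> w = (\<zeta> * fst z, inverse \<zeta> * snd z))" .
qed (rule m_pos)

text \<open>The only fibre outside the chart is the circle \<open>z1 = 0\<close>, which is the core of the chart obtained by swapping
  the coordinates.\<close>

lemma fibre_multiplicity_quotient:
  fixes p1 p2 :: nat
  defines "m' \<equiv> m div gcd m (p1 + p2)"
  assumes p: "p1 \<ge> 1" "p2 \<ge> 1" "coprime p1 p2" and z: "z \<in> sphere 0 1"
  shows "fibre_multiplicity X (quotient_fibre q p1 p2 ` sphere 0 1) (quotient_fibre q p1 p2 z)
    (if snd z = 0 then m' * p1 else if fst z = 0 then m' * p2 else 1)"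
proof (cases "fst z = 0")
  case False
  with fibre_multiplicity_in_chart[OF p(1,3) z False] show ?thesis by (simp add: m'_def split: if_splits)
next
  case True
  \<comment> \<open>The pair \<open>(p2, p1)\<close> and the swapped presentation give the same fibration.\<close>
  interpret swapped: lens_quotient m X "q \<circ> prod.swap" by (rule lens_quotient_swap)
  have norm_swap: "norm (prod.swap z) = norm z" for z :: "complex \<times> complex"
    by (simp add: norm_prod_def add.commute)
  have act: "prod.swap (circle_action (int p2) (int p1) \<theta> w) = circle_action (int p1) (int p2) \<theta> (prod.swap w)" for \<theta> w
    by (simp add: circle_action_eq)
  have fib: "quotient_fibre (q \<circ> prod.swap) p2 p1 w = quotient_fibre q p1 p2 (prod.swap w)" for w
    by (simp add: quotient_fibre_def image_image act)
  have "prod.swap ` sphere 0 1 = sphere (0 :: complex \<times> complex) 1"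
  proof -
    have "z = prod.swap (prod.swap z)" for z :: "complex \<times> complex" by simp
    then show ?thesis using norm_swap by (auto simp del: swap_swap intro!: image_eqI)
  qed
  then have F: "quotient_fibre (q \<circ> prod.swap) p2 p1 ` sphere 0 1 = quotient_fibre q p1 p2 ` sphere 0 1"
    unfolding fib by (simp only: image_image[symmetric, of "quotient_fibre q p1 p2" prod.swap])
  have "snd z \<noteq> 0" using True z by (cases z) auto
  then show ?thesis
    using swapped.fibre_multiplicity_in_chart[of p2 p1 "prod.swap z"] p z True
    unfolding F fib by (simp add: norm_swap m'_def add.commute coprime_commute)
qed

text \<open>The fibres in the quotient are the orbits on \<open>S\<^sup>3\<close> of the circle combined with the \<open>m\<close>-th roots of unity,
  and these are the level sets of the base map whose exponents are the two multiplicities.\<close>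

lemma mem_quotient_fibre_iff:
  fixes p1 p2 :: nat
  defines "m' \<equiv> m div gcd m (p1 + p2)"
  assumes p: "p1 \<ge> 1" "p2 \<ge> 1" "coprime p1 p2" and z: "z \<in> sphere 0 1" and w: "w \<in> sphere 0 1"
  shows "q w \<in> quotient_fibre q p1 p2 z
    \<longleftrightarrow> base_map (m' * p1) (m' * p2) w = base_map (m' * p1) (m' * p2) z"
proof -
  have m': "m' \<ge> 1" unfolding m'_def by (rule div_gcd_ge_1[OF m_pos])
  have "base_map (m' * p1) (m' * p2) w = base_map (m' * p1) (m' * p2) z \<longleftrightarrow>
    (\<exists>x y. cmod x = 1 \<and> cmod y = 1 \<and> x ^ (m' * p2) = y ^ (m' * p1) \<and> w = (x * fst z, y * snd z))"
    using base_map_eq_iff[of "m' * p1" "m' * p2" z w] z w m' p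
    unfolding sphere_prod_iff by (auto simp: Suc_le_eq)
  also have "\<dots> \<longleftrightarrow> (\<exists>\<zeta> \<theta>. \<zeta> ^ m = 1 \<and>
      w = (\<zeta> * cis (real p1 * \<theta>) * fst z, inverse \<zeta> * cis (real p2 * \<theta>) * snd z))" (is "?L \<longleftrightarrow> ?R")
  proof
    assume ?L
    then obtain x y where "cmod x = 1" "cmod y = 1" "x ^ (m' * p2) = y ^ (m' * p1)"
      "w = (x * fst z, y * snd z)" by blast
    with torus_subgroup[OF m_pos p(1,3), of x y] show ?R unfolding m'_def by blast
  next
    assume ?R
    then obtain \<zeta> \<theta> where \<zeta>: "\<zeta> ^ m = 1"
      "w = (\<zeta> * cis (real p1 * \<theta>) * fst z, inverse \<zeta> * cis (real p2 * \<theta>) * snd z)" by blast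
    have "cmod \<zeta> = 1" using norm_root_of_unity[OF \<zeta>(1) m_pos] .
    then have "cmod (\<zeta> * cis (real p1 * \<theta>)) = 1" "cmod (inverse \<zeta> * cis (real p2 * \<theta>)) = 1"
      by (simp_all add: norm_mult norm_inverse)
    with torus_subgroup[OF m_pos p(1,3) this] \<zeta> show ?L unfolding m'_def by blast
  qed
  also have "\<dots> \<longleftrightarrow> (\<exists>\<theta>. q (circle_action (int p1) (int p2) \<theta> z) = q w)"
    unfolding q_eq_iff[OF circle_action_sphere[OF z] w] by (auto simp: circle_action_eq mult.assoc)
  also have "\<dots> \<longleftrightarrow> q w \<in> quotient_fibre q p1 p2 z"
    unfolding quotient_fibre_def image_image by (auto simp: image_iff eq_commute[of "q w"])
  finally show ?thesis by (rule sym)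
qed

text \<open>The fibration of \<open>L(m, m - 1)\<close> for every \<open>m\<close>: its base is a sphere because its fibres are the level sets
  of \<open>base_map\<close>, and the circles \<open>z2 = 0\<close> and \<open>z1 = 0\<close> lie over the north and the south pole.\<close>

lemma seifert_fibration_quotient:
  fixes p1 p2 :: nat
  defines "F \<equiv> descended q (S3_fibration p1 p2)" and "m' \<equiv> m div gcd m (p1 + p2)"
  assumes p: "p1 \<ge> 1" "p2 \<ge> 1" "coprime p1 p2"
  shows "seifert_fibration X F" "has_base_orbifold X F (S2_orbifold (m' * p1) (m' * p2))"
proof -
  let ?a = "m' * p1" and ?b = "m' * p2"
  let ?B = "base_map ?a ?b" and ?f = "quotient_fibre q p1 p2"
  have F: "F = ?f ` sphere 0 1" by (simp add: F_def descended_S3_fibration)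
  have m': "m' \<ge> 1" unfolding m'_def by (rule div_gcd_ge_1[OF m_pos])
  have b: "?b \<ge> 1" using m' p by simp
  have mult: "fibre_multiplicity X F (?f z)
      (if snd z = 0 then ?a else if fst z = 0 then ?b else 1)" if "z \<in> sphere 0 1" for z
    using fibre_multiplicity_quotient[OF p that] by (simp only: F m'_def)
  have level: "q w \<in> ?f z \<longleftrightarrow> ?B w = ?B z" if "z \<in> sphere 0 1" "w \<in> sphere 0 1" for z w
    using mem_quotient_fibre_iff[OF p that] by (simp only: m'_def)
  have cont: "continuous_map S3 (top_of_set (sphere 0 1)) ?B"
    using continuous_on_base_map[of "sphere 0 1" ?a ?b] base_map_image[OF b, of ?a]
    by (auto simp: S3_def continuous_map_in_subtopology)
  have B_quot: "quotient_map S3 (top_of_set (sphere 0 1)) ?B"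
    using cont base_map_image[OF b, of ?a]
    by (intro T1_Spaces.continuous_imp_quotient_map)
      (auto simp: S3_def compact_space_subtopology Hausdorff_space_subtopology)
  have "?B z = ?B w" if zw: "z \<in> sphere 0 1" "w \<in> sphere 0 1" "q z = q w" for z w
    using level[OF zw(1,2)] mem_quotient_fibre_self[of q z p1 p2] zw(3) by simp
  then obtain Bq where Bq: "continuous_map X (top_of_set (sphere 0 1)) Bq"
    "\<And>z. z \<in> sphere 0 1 \<Longrightarrow> Bq (q z) = ?B z"
    using quotient_map_lift_exists[OF quot cont] unfolding topspace_S3 by metis
  have "quotient_map S3 (top_of_set (sphere 0 1)) (Bq \<circ> q)"
    by (rule quotient_map_eq[OF B_quot]) (simp add: Bq(2))
  then have Bq_quot: "quotient_map X (top_of_set (sphere 0 1)) Bq"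
    by (rule quotient_map_from_composition[OF quotient_imp_continuous_map[OF quot] Bq(1)])
  have level_q: "?f z = {x \<in> topspace X. Bq x = Bq (q z)}" if z: "z \<in> sphere 0 1" for z
  proof -
    have "?f z \<subseteq> q ` sphere 0 1"
      using circle_action_sphere[OF z] by (auto simp: quotient_fibre_def simp del: mem_sphere_0)
    then show ?thesis
      unfolding q_image[symmetric] using level[OF z] z by (auto simp: Bq(2))
  qed
  have F_level: "F = (\<lambda>x. {x' \<in> topspace X. Bq x' = Bq x}) ` topspace X"
    unfolding F q_image[symmetric] image_image
    by (intro image_cong refl) (simp only: level_q q_image)
  note decomp = decomposition_space_of_level_sets[OF Bq_quot F_level]
  show "seifert_fibration X F"
    unfolding seifert_fibration_def
  proof (intro conjI ballI)
    fix f assume "f \<in> F"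
    then obtain z where "z \<in> sphere 0 1" "f = ?f z" unfolding F by blast
    with mult show "\<exists>\<alpha>. fibre_multiplicity X F f \<alpha>" by blast
  qed (rule Hausdorff_and_second_countable decomp(1))+
  obtain h where h: "homeomorphic_map (decomposition_space X F) (top_of_set (sphere 0 1)) h"
    "\<And>x. x \<in> topspace X \<Longrightarrow> h {x' \<in> topspace X. Bq x' = Bq x} = Bq x"
    using decomp(2) by blast
  have h_fibre: "h (?f z) = ?B z" if z: "z \<in> sphere 0 1" for z
    using h(2)[of "q z"] z q_image by (simp only: level_q[OF z] Bq(2)[OF z]) blast
  have "fibre_multiplicity X F (?f z) (snd (S2_orbifold ?a ?b) (h (?f z)))" if z: "z \<in> sphere 0 1" for z
    using mult[OF z] base_map_poles[of z ?a ?b] z[unfolded sphere_prod_iff]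
    by (simp add: S2_orbifold_def h_fibre[OF z] split: if_splits)
  then have "\<forall>f\<in>F. fibre_multiplicity X F f (snd (S2_orbifold ?a ?b) (h f))"
    unfolding F by blast
  with h(1) show "has_base_orbifold X F (S2_orbifold ?a ?b)"
    unfolding has_base_orbifold_def by (intro exI[of _ h]) (simp add: S2_orbifold_def)
qed

end

section \<open>The sphere and the lens space as quotients\<close>

lemma lens_quotient_S3: "lens_quotient 1 S3 id"
proof
  show "quotient_map S3 S3 id" by (simp add: quotient_map_def Collect_conj_eq Int_absorb1 del: topspace_S3)
qed (auto simp: prod_eq_iff)

lemma lens_generator_power:
  "(lens_generator m ^^ j) z = (cis (2 * pi * j / m) * fst z, inverse (cis (2 * pi * j / m)) * snd z)"
proof (induction j)
  case (Suc j)
  have "lens_generator m w = (cis (2 * pi / m) * fst w, cis (- (2 * pi / m)) * snd w)" for w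
    by (simp add: lens_generator_def case_prod_beta cis_conv_exp mult_ac)
  moreover have "cis (2 * pi * Suc j / m) = cis (2 * pi / m) * cis (2 * pi * j / m)"
    by (simp add: cis_mult add_divide_distrib distrib_left)
  ultimately show ?case
    using Suc by (simp add: mult.assoc del: of_nat_Suc)
qed simp

lemma lens_proj_eq:
  assumes "m \<ge> 1"
  shows "lens_proj m z = {(\<zeta> * fst z, inverse \<zeta> * snd z) |\<zeta>. \<zeta> ^ m = 1}"
proof -
  have "{\<zeta>. \<zeta> ^ m = 1} = range (\<lambda>j::nat. cis (2 * pi * j / m))"
  proof (intro equalityI subsetI)
    fix \<zeta> :: complex assume "\<zeta> \<in> {\<zeta>. \<zeta> ^ m = 1}"
    then obtain j where "\<zeta> = cis (2 * pi * real j / m)"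
      using complex_roots_unity[of m] assms by (auto simp: cis_conv_exp mult_ac)
    then show "\<zeta> \<in> range (\<lambda>j::nat. cis (2 * pi * j / m))" by blast
  next
    fix \<zeta> assume "\<zeta> \<in> range (\<lambda>j::nat. cis (2 * pi * j / m))"
    then obtain j :: nat where "\<zeta> = cis (2 * pi * j / m)" by blast
    then have "\<zeta> ^ m = cis (m * (2 * pi * j / m))" by (simp only: Complex.DeMoivre)
    also have "\<dots> = cis (2 * pi * of_int (int j))" using assms by simp
    also have "\<dots> = 1" by (rule cis_multiple_2pi) simp
    finally show "\<zeta> \<in> {\<zeta>. \<zeta> ^ m = 1}" by simp
  qed
  then have "(\<lambda>\<zeta>. (\<zeta> * fst z, inverse \<zeta> * snd z)) ` {\<zeta>. \<zeta> ^ m = 1} = lens_proj m z"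
    unfolding lens_proj_def lens_generator_power by (simp only: image_image)
  then show ?thesis by auto
qed

lemma lens_quotient_lens_space:
  assumes m: "m \<ge> 1"
  shows "lens_quotient m (lens_space m) (lens_proj m)"
proof -
  define R where "R = (\<lambda>z w :: complex \<times> complex. \<exists>\<zeta>. \<zeta> ^ m = 1 \<and> w = (\<zeta> * fst z, inverse \<zeta> * snd z))"
  have R_iff: "R z w \<longleftrightarrow> lens_invariants m z = lens_invariants m w" for z w
    by (simp only: R_def lens_invariants_eq_iff[OF m])
  have proj: "lens_proj m z = {w. R z w}" for z
    unfolding lens_proj_eq[OF m] R_def by blast
  have proj_eq: "lens_proj m z = lens_proj m w \<longleftrightarrow> R z w" for z w
    unfolding proj R_iff by auto
  have norm_R: "norm w = norm z" if R: "R z w" for z w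
  proof -
    obtain \<zeta> where \<zeta>: "\<zeta> ^ m = 1" "w = (\<zeta> * fst z, inverse \<zeta> * snd z)" using R by (auto simp: R_def)
    have "cmod \<zeta> = 1" using norm_root_of_unity[OF \<zeta>(1) m] .
    then show ?thesis by (simp add: \<zeta>(2) norm_prod_def norm_mult norm_inverse)
  qed
  have "partition_on (topspace S3) (lens_proj m ` topspace S3)"
    unfolding partition_on_def topspace_S3
  proof (intro conjI)
    show "\<Union> (lens_proj m ` sphere 0 1) = sphere 0 1"
    proof (intro equalityI subsetI)
      fix w assume "w \<in> \<Union> (lens_proj m ` sphere 0 1)"
      then obtain z where "z \<in> sphere 0 1" "R z w" by (auto simp: proj)
      then show "w \<in> sphere 0 1" using norm_R by simp
    next
      fix w :: "complex \<times> complex" assume "w \<in> sphere 0 1"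
      moreover have "w \<in> lens_proj m w" by (simp add: proj R_iff)
      ultimately show "w \<in> \<Union> (lens_proj m ` sphere 0 1)" by blast
    qed
    show "disjoint (lens_proj m ` sphere 0 1)"
      by (auto simp: disjoint_def proj R_iff)
    have "z \<in> lens_proj m z" for z by (simp add: proj R_iff)
    then show "{} \<notin> lens_proj m ` sphere 0 1" by blast
  qed
  then have "quotient_map S3 (lens_space m) (lens_proj m)"
    unfolding lens_space_def
    by (rule quotient_map_decomposition_space) (simp add: proj R_iff)
  then show ?thesis
    using m proj_eq by unfold_locales (auto simp: R_def)
qed

lemma S3_fibration_descends_to_lens_space:
  fixes p1 p2 m :: nat
  defines "m' \<equiv> m div gcd m (p1 + p2)"
  assumes m: "m \<ge> 1" and p: "p1 \<ge> 1" "p2 \<ge> 1" "coprime p1 p2"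
  shows "S3_fibration_descends p1 p2 m (m' * p1) (m' * p2)"
proof -
  have "descended id (S3_fibration p1 p2) = S3_fibration p1 p2" by (simp add: descended_def)
  then show ?thesis
    unfolding S3_fibration_descends_def m'_def
    using lens_quotient.seifert_fibration_quotient[OF lens_quotient_S3 p]
      lens_quotient.seifert_fibration_quotient[OF lens_quotient_lens_space[OF m] p] by simp
qed

theorem proposition7p6:
  fixes k1 k2 :: nat
  assumes "k1 \<ge> 1" and "k2 \<ge> 1"
  shows "(\<exists>p1 p2 m. p1 \<ge> 1 \<and> p2 \<ge> 1 \<and> m \<ge> 1 \<and> coprime p1 p2 \<and>
            S3_fibration_descends p1 p2 m k1 k2) \<and>
         (\<forall>p1 p2. p1 \<ge> 1 \<and> p2 \<ge> 1 \<and> coprime p1 p2 \<and> real p1 / real p2 = real k1 / real k2 \<longrightarrow>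
            S3_fibration_descends p1 p2 (k1 + k2) k1 k2)"
proof -
  have main: "S3_fibration_descends p1 p2 (k1 + k2) k1 k2"
    if p: "p1 \<ge> 1" "p2 \<ge> 1" "coprime p1 p2" and ratio: "real p1 / real p2 = real k1 / real k2" for p1 p2
  proof -
    have "real p1 * real k2 = real k1 * real p2" using ratio p(2) assms(2) by (simp add: field_simps)
    then have eq: "p1 * k2 = k1 * p2" by (metis of_nat_eq_iff of_nat_mult)
    then have "p1 dvd k1 * p2" by (metis dvd_triv_left)
    then have "p1 dvd k1" using p(3) by (simp add: coprime_dvd_mult_left_iff)
    then obtain d where d: "k1 = d * p1" by (metis dvd_div_mult_self)
    with eq p(1) have d2: "k2 = d * p2" by simp
    have "d \<ge> 1" using assms(1) d by (simp add: Suc_le_eq)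
    have sum: "k1 + k2 = d * (p1 + p2)" using d d2 by (simp add: distrib_left)
    \<comment> \<open>As \<open>p1 + p2\<close> divides \<open>m = k1 + k2\<close>, the multiplicities are \<open>d * p1 = k1\<close> and \<open>d * p2 = k2\<close>.\<close>
    have "(k1 + k2) div gcd (k1 + k2) (p1 + p2) = d" using p(1) by (simp add: sum)
    then show ?thesis
      using S3_fibration_descends_to_lens_space[of "k1 + k2" p1 p2] assms p d d2 by simp
  qed
  define d where "d = gcd k1 k2"
  have d: "d \<ge> 1" using assms by (simp add: d_def Suc_le_eq)
  have k: "k1 = d * (k1 div d)" "k2 = d * (k2 div d)" by (simp_all add: d_def)
  have p: "k1 div d \<ge> 1" "k2 div d \<ge> 1"
    using div_gcd_ge_1[OF assms(1), of k2] div_gcd_ge_1[OF assms(2), of k1]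
    by (simp_all add: d_def gcd.commute)
  have cop: "coprime (k1 div d) (k2 div d)"
    unfolding d_def using assms by (intro div_gcd_coprime) simp
  have "real k1 / real k2 = (real d * real (k1 div d)) / (real d * real (k2 div d))"
    using k by (metis of_nat_mult)
  then have "real (k1 div d) / real (k2 div d) = real k1 / real k2" using d by simp
  from main[OF p cop this] have "\<exists>p1 p2 m. p1 \<ge> 1 \<and> p2 \<ge> 1 \<and> m \<ge> 1 \<and> coprime p1 p2 \<and>
            S3_fibration_descends p1 p2 m k1 k2"
    using p cop assms by (intro exI[of _ "k1 div d"] exI[of _ "k2 div d"] exI[of _ "k1 + k2"]) simp
  with main show ?thesis by blast
qed

end
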